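(* There exists a positive integer $n_0$ such that for all $n \geq n_0$ the following holds: every finite set $\mathcal{X} \subset \mathbb{R}^3$ in general position with $|\mathcal{X}| \geq ES_3(8n)$ contains a collection of subsets $X_1, \ldots, X_n \subset \mathcal{X}$ which is in convex position and satisfies $|X_i| \geq |\mathcal{X}| / ES_3(8n)^8$ for every $i = 1, \ldots, n$.
   Context: A set $X \subset \mathbb{R}^d$ with $|X| \geq d+1$ is in general position if no $d+1$ points of $X$ lie on a common affine hyperplane. A finite point set is in convex position if its points are the vertices of a convex polytope. $ES_d(n)$ denotes the smallest integer $N$ such that every set of $N$ points in general position in $\mathbb{R}^d$ contains $n$ points in convex position. A collection of sets $X_1, \ldots, X_n \subset \mathbb{R}^d$ is in convex position if for every $i = 1, \ldots, n$ the convex hulls $\mathrm{conv}(X_i)$ and $\mathrm{conv}(\bigcup_{j \neq i} X_j)$ are disjoint. *)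

theory Defs
  imports "HOL-Analysis.Analysis"
begin

definition affine_hyperplane :: "'a::euclidean_space set \<Rightarrow> bool" where
  "affine_hyperplane H \<longleftrightarrow> (\<exists>a b. a \<noteq> 0 \<and> H = {x. a \<bullet> x = b})"

text \<open>The size condition is guarded by finiteness because \<^const>\<open>card\<close> is 0 on infinite sets.\<close>

definition in_general_position :: "'a::euclidean_space set \<Rightarrow> bool" where
  "in_general_position X \<longleftrightarrow>
     (finite X \<longrightarrow> DIM('a) + 1 \<le> card X) \<and>
     \<not> (\<exists>Y H. Y \<subseteq> X \<and> card Y = DIM('a) + 1 \<and> affine_hyperplane H \<and> Y \<subseteq> H)"

definition in_convex_position :: "'a::euclidean_space set \<Rightarrow> bool" where
  "in_convex_position X \<longleftrightarrow> finite X \<and> (\<exists>P. polytope P \<and> X = {x. x extreme_point_of P})"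

text \<open>\<open>ES TYPE('a) n\<close> is the Erdos-Szekeres number \<open>ES\<^sub>d(n)\<close> for \<open>d = DIM('a)\<close>. The bound
  \<open>DIM('a) + 1 \<le> N\<close> restricts the minimum to the sizes for which general position is
  defined; without it the condition would hold vacuously at \<open>N = 0\<close>.\<close>

definition ES :: "'a::euclidean_space itself \<Rightarrow> nat \<Rightarrow> nat" where
  "ES _ n = (LEAST N. DIM('a) + 1 \<le> N \<and>
     (\<forall>X::'a set. finite X \<and> card X = N \<and> in_general_position X \<longrightarrow>
        (\<exists>Y. Y \<subseteq> X \<and> card Y = n \<and> in_convex_position Y)))"

definition family_in_convex_position :: "'i set \<Rightarrow> ('i \<Rightarrow> 'a::euclidean_space set) \<Rightarrow> bool" where
  "family_in_convex_position I X \<longleftrightarrow>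
     (\<forall>i\<in>I. convex hull (X i) \<inter> convex hull (\<Union>j\<in>I - {i}. X j) = {})"

end

theory Submission
  imports "HOL-Library.Ramsey" Defs
begin

text \<open>
  Let \<open>N = ES\<^sub>3(8n)\<close>. By averaging over the \<open>N\<close>-point subsets, at least a fraction
  \<open>1 / (N choose 8n)\<close> of all \<open>8n\<close>-point subsets of \<open>\<X>\<close> are in convex position. If \<open>\<X>\<close> contained
  no large family in convex position, there would be fewer of them.

  Let \<open>W\<close> be in convex position and \<open>z\<close> a generic point inside a tetrahedron spanned by four
  points of \<open>W\<close>. For a vertex \<open>v\<close> of \<open>W\<close>, let \<open>f(v)\<close> be the facet of \<open>conv (W - v)\<close> through which
  the segment from \<open>v\<close> to \<open>z\<close> enters; it is unchanged when a point outside \<open>f(v)\<close> is deleted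
  from \<open>W\<close>. The \<open>cell\<close> of \<open>v\<close> consists of the points of \<open>\<X>\<close> that lie beyond \<open>f(v)\<close> and on the
  same side as \<open>v\<close> of the at most \<open>|W|\<close> facet planes belonging to \<open>W - v\<close> in the same way. If no
  vertex in \<open>T\<close> lies on the facet of another one, the cells of \<open>T\<close> are in convex position, since
  the plane of \<open>f(v)\<close> separates the cell of \<open>v\<close> from all the others. The digraph with an edge from
  \<open>v\<close> to the three points of \<open>f(v)\<close> has an independent set containing a seventh of its vertices.
  Hence, unless the theorem holds, every \<open>W\<close> with more than \<open>7n\<close> points has a vertex with a cell
  of fewer than \<open>|\<X>| / N\<^sup>8\<close> points, and \<open>n\<close> such vertices can be removed in succession from an
  \<open>8n\<close>-point set. Undoing a removal leaves \<open>O(n\<^sup>6)\<close> choices for the cell, which bounds the number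
  of \<open>8n\<close>-point sets in convex position; comparing both bounds gives \<open>n! \<le> C\<^sup>n\<close>.
\<close>

hide_const (open) Ramsey.ES

subsection \<open>Convex position and the Erdos-Szekeres theorem in dimension three\<close>

text \<open>Working form of convex position: unlike the polytope formulation it is visibly inherited
  by subsets. Finiteness is kept separate.\<close>

definition convex_independent :: "'a::real_vector set \<Rightarrow> bool" where
  "convex_independent W \<longleftrightarrow> (\<forall>w\<in>W. w \<notin> convex hull (W - {w}))"

lemma convex_independent_subset:
  assumes "convex_independent W" "V \<subseteq> W"
  shows "convex_independent V"
  unfolding convex_independent_def
proof
  fix v assume "v \<in> V"
  have "convex hull (V - {v}) \<subseteq> convex hull (W - {v})"
    using assms by (intro hull_mono) auto
  then show "v \<notin> convex hull (V - {v})"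
    using assms \<open>v \<in> V\<close> unfolding convex_independent_def by blast
qed

text \<open>Removing an extreme point \<open>w\<close> leaves \<open>P\<close> convex, so the hull
  of the other extreme points stays inside \<open>P - {w}\<close>. Conversely, the hull of
  \<open>W\<close> serves as \<open>P\<close>.\<close>

lemma in_convex_position_iff:
  fixes W :: "'a::euclidean_space set"
  shows "in_convex_position W \<longleftrightarrow> finite W \<and> convex_independent W"
proof
  assume "in_convex_position W"
  then obtain P where P: "finite W" "polytope P" "W = {x. x extreme_point_of P}"
    unfolding in_convex_position_def by blast
  have cP: "convex P"
    using P polytope_imp_convex by blast
  have "w \<notin> convex hull (W - {w})" if "w \<in> W" for w
  proof -
    have "convex (P - {w})"
      using that P cP by (simp add: extreme_point_of_stillconvex)
    moreover have "W - {w} \<subseteq> P - {w}"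
      using P by (auto simp: extreme_point_of_def)
    ultimately have "convex hull (W - {w}) \<subseteq> P - {w}"
      by (rule hull_minimal[rotated])
    then show ?thesis by blast
  qed
  then show "finite W \<and> convex_independent W"
    using P by (simp add: convex_independent_def)
next
  assume W: "finite W \<and> convex_independent W"
  then have "x extreme_point_of (convex hull W) \<longleftrightarrow> x \<in> W" for x
    by (intro extreme_point_of_convex_hull_convex_independent)
      (auto simp: finite_imp_compact convex_independent_def)
  moreover have "polytope (convex hull W)"
    using W polytope_def by blast
  ultimately show "in_convex_position W"
    unfolding in_convex_position_def using W by blast
qed

lemma in_general_position_card_hyperplane:
  fixes X :: "'a::euclidean_space set"
  assumes "in_general_position X" "finite X" "a \<noteq> 0" "Y \<subseteq> X" "Y \<subseteq> {x. a \<bullet> x = b}"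
  shows "card Y \<le> DIM('a)"
proof (rule ccontr)
  assume "\<not> ?thesis"
  then obtain Z where "Z \<subseteq> Y" "card Z = DIM('a) + 1"
    by (metis Suc_eq_plus1 not_less_eq_eq obtain_subset_with_card_n)
  moreover have "affine_hyperplane {x. a \<bullet> x = b}"
    using assms unfolding affine_hyperplane_def by blast
  ultimately show False
    using assms unfolding in_general_position_def by (meson subset_trans)
qed

lemma in_general_position_subset:
  fixes X :: "'a::euclidean_space set"
  assumes "in_general_position X" "Y \<subseteq> X" "DIM('a) + 1 \<le> card Y"
  shows "in_general_position Y"
  using assms unfolding in_general_position_def by (meson subset_trans)

text \<open>Will be applied to the slopes at a vertex. The empty cases matter: the leftmost and
  rightmost vertices have no slopes on one side.\<close>

lemma finite_sets_separating_real:
  fixes L R :: "real set"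
  assumes "finite L" "finite R" "\<And>l r. l \<in> L \<Longrightarrow> r \<in> R \<Longrightarrow> l < r"
  obtains c where "\<forall>l\<in>L. l < c" "\<forall>r\<in>R. c < r"
proof (cases "L = {} \<or> R = {}")
  case True
  show ?thesis
  proof (cases "L = {}")
    case True
    obtain b where "\<forall>r\<in>R. b \<le> r"
      using bdd_below_finite[OF assms(2)] by (auto simp: bdd_below_def)
    then have "\<forall>r\<in>R. b - 1 < r"
      by fastforce
    then show ?thesis using that True by blast
  next
    case False
    obtain b where "\<forall>l\<in>L. l \<le> b"
      using bdd_above_finite[OF assms(1)] by (auto simp: bdd_above_def)
    then have "\<forall>l\<in>L. l < b + 1"
      by fastforce
    then show ?thesis using that False \<open>L = {} \<or> R = {}\<close> by blast
  qed
next
  case False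
  then have "Max L < Min R"
    using assms by simp
  then obtain c where "Max L < c" "c < Min R"
    using dense by blast
  then show ?thesis
    using that False assms by simp
qed

text \<open>Each vertex is exposed by a functional whose slope lies between the slopes to its left and
  to its right.\<close>

lemma convex_independent_cup:
  fixes W :: "'a::euclidean_space set"
  assumes "finite W" and inj: "inj_on (\<lambda>x. a \<bullet> x) W"
    and cup: "\<And>p q r. \<lbrakk>p \<in> W; q \<in> W; r \<in> W; a \<bullet> p < a \<bullet> q; a \<bullet> q < a \<bullet> r\<rbrakk> \<Longrightarrow>
       (b \<bullet> q - b \<bullet> p) * (a \<bullet> r - a \<bullet> q) < (b \<bullet> r - b \<bullet> q) * (a \<bullet> q - a \<bullet> p)"
  shows "convex_independent W"
  unfolding convex_independent_def
proof
  fix w assume w: "w \<in> W"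
  define L where "L = (\<lambda>p. (b \<bullet> w - b \<bullet> p) / (a \<bullet> w - a \<bullet> p)) ` {p \<in> W. a \<bullet> p < a \<bullet> w}"
  define R where "R = (\<lambda>r. (b \<bullet> r - b \<bullet> w) / (a \<bullet> r - a \<bullet> w)) ` {r \<in> W. a \<bullet> w < a \<bullet> r}"
  have "l < r" if l: "l \<in> L" and r: "r \<in> R" for l r
  proof -
    obtain p where p: "p \<in> W" "a \<bullet> p < a \<bullet> w" "l = (b \<bullet> w - b \<bullet> p) / (a \<bullet> w - a \<bullet> p)"
      using l by (auto simp: L_def)
    obtain q where q: "q \<in> W" "a \<bullet> w < a \<bullet> q" "r = (b \<bullet> q - b \<bullet> w) / (a \<bullet> q - a \<bullet> w)"
      using r by (auto simp: R_def)
    show ?thesis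
      unfolding p(3) q(3) using cup[OF p(1) w q(1) p(2) q(2)] p(2) q(2) by (simp add: divide_simps)
  qed
  moreover have "finite L" "finite R"
    using \<open>finite W\<close> by (auto simp: L_def R_def)
  ultimately obtain c where c: "\<forall>l\<in>L. l < c" "\<forall>r\<in>R. c < r"
    using finite_sets_separating_real by metis
  have "(b - c *\<^sub>R a) \<bullet> w < (b - c *\<^sub>R a) \<bullet> x" if x: "x \<in> W - {w}" for x
  proof -
    have "a \<bullet> x \<noteq> a \<bullet> w"
      using inj x w by (auto dest: inj_onD)
    then consider "a \<bullet> x < a \<bullet> w" | "a \<bullet> w < a \<bullet> x" by linarith
    then show ?thesis
    proof cases
      case 1
      then have "(b \<bullet> w - b \<bullet> x) / (a \<bullet> w - a \<bullet> x) < c"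
        using c(1) x unfolding L_def by blast
      with 1 have "b \<bullet> w - b \<bullet> x < c * (a \<bullet> w - a \<bullet> x)"
        by (simp add: divide_simps)
      then show ?thesis by (simp add: inner_diff_left algebra_simps)
    next
      case 2
      then have "c < (b \<bullet> x - b \<bullet> w) / (a \<bullet> x - a \<bullet> w)"
        using c(2) x unfolding R_def by blast
      with 2 have "c * (a \<bullet> x - a \<bullet> w) < b \<bullet> x - b \<bullet> w"
        by (simp add: divide_simps)
      then show ?thesis by (simp add: inner_diff_left algebra_simps)
    qed
  qed
  then have "convex hull (W - {w}) \<subseteq> {x. (b - c *\<^sub>R a) \<bullet> x > (b - c *\<^sub>R a) \<bullet> w}"
    by (intro hull_minimal) (auto simp: convex_halfspace_gt)
  then show "w \<notin> convex hull (W - {w})" by blast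
qed

text \<open>Ramsey's theorem colours unordered triples, so the order is recovered from the first
  coordinate. Slopes of the projection to the first two coordinates are compared with denominators
  cleared: 0 is a cup, 1 a cap, 2 a collinear triple. 2 is also the default when first coordinates
  coincide.\<close>

definition orientation_colour :: "(real^3) set \<Rightarrow> nat" where
  "orientation_colour T =
     (if \<exists>p q r. T = {p,q,r} \<and> p$1 < q$1 \<and> q$1 < r$1 \<and>
            (q$2 - p$2) * (r$1 - q$1) < (r$2 - q$2) * (q$1 - p$1) then 0
      else if \<exists>p q r. T = {p,q,r} \<and> p$1 < q$1 \<and> q$1 < r$1 \<and>
            (q$2 - p$2) * (r$1 - q$1) > (r$2 - q$2) * (q$1 - p$1) then 1
      else 2)"

lemma sorted_triple_eq:
  fixes f :: "'a \<Rightarrow> 'b::linorder"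
  assumes "{p,q,r} = {p',q',r'}" "f p < f q" "f q < f r" "f p' < f q'" "f q' < f r'"
  shows "p = p' \<and> q = q' \<and> r = r'"
proof -
  have "p \<in> {p',q',r'}" "q \<in> {p',q',r'}" "r \<in> {p',q',r'}"
    using assms(1) by auto
  then show ?thesis using assms(2-5) by auto
qed

lemma order_colour_cases:
  fixes x y :: real and c :: nat
  assumes "c = (if x < y then 0 else if x > y then 1 else 2)"
  shows "c = 0 \<longleftrightarrow> x < y" "c = 1 \<longleftrightarrow> y < x" "c = 2 \<longleftrightarrow> x = y"
  using assms by auto

text \<open>A triple has only one increasing listing, so the existential quantifiers in the
  definition collapse.\<close>

lemma orientation_colour_eq:
  assumes "p$1 < q$1" "q$1 < r$1"
  shows "orientation_colour {p,q,r} =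
    (if (q$2 - p$2) * (r$1 - q$1) < (r$2 - q$2) * (q$1 - p$1) then 0
     else if (q$2 - p$2) * (r$1 - q$1) > (r$2 - q$2) * (q$1 - p$1) then 1 else 2)"
proof -
  have eq: "p' = p \<and> q' = q \<and> r' = r"
    if "{p,q,r} = {p',q',r'}" "p'$1 < q'$1" "q'$1 < r'$1" for p' q' r' :: "real^3"
    using sorted_triple_eq[of p q r p' q' r' "\<lambda>x. x$1"] that assms by simp
  have "(\<exists>p' q' r'. {p,q,r} = {p',q',r'} \<and> p'$1 < q'$1 \<and> q'$1 < r'$1 \<and> Q p' q' r') \<longleftrightarrow> Q p q r"
    for Q :: "real^3 \<Rightarrow> real^3 \<Rightarrow> real^3 \<Rightarrow> bool"
  proof
    assume "\<exists>p' q' r'. {p,q,r} = {p',q',r'} \<and> p'$1 < q'$1 \<and> q'$1 < r'$1 \<and> Q p' q' r'"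
    then obtain p' q' r' where *: "{p,q,r} = {p',q',r'}" "p'$1 < q'$1" "q'$1 < r'$1" "Q p' q' r'"
      by blast
    show "Q p q r" using eq[OF *(1-3)] *(4) by simp
  next
    assume "Q p q r"
    then show "\<exists>p' q' r'. {p,q,r} = {p',q',r'} \<and> p'$1 < q'$1 \<and> q'$1 < r'$1 \<and> Q p' q' r'"
      using assms by blast
  qed
  then show ?thesis
    unfolding orientation_colour_def by (simp only:)
qed

text \<open>Each fibre of the functional lies in a hyperplane and so has at most
  \<open>DIM('a)\<close> points; \<open>Y\<close> takes one point from each fibre.\<close>

lemma in_general_position_inj_on_subset:
  fixes X :: "'a::euclidean_space set"
  assumes X: "finite X" "in_general_position X" and "a \<noteq> 0"
  obtains Y where "Y \<subseteq> X" "inj_on (\<lambda>x. a \<bullet> x) Y" "card X \<le> card Y * DIM('a)"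
proof -
  let ?s = "\<lambda>x. a \<bullet> x"
  obtain Y where Y: "Y \<subseteq> X" "inj_on ?s Y" "?s ` X = ?s ` Y"
    using subset_image_inj[of "?s ` X" ?s X] by auto
  have "card X = card (\<Union>c\<in>?s ` X. {x\<in>X. ?s x = c})"
    by (rule arg_cong[of _ _ card]) auto
  also have "\<dots> \<le> (\<Sum>c\<in>?s ` X. card {x\<in>X. ?s x = c})"
    using X by (intro card_UN_le) auto
  also have "\<dots> \<le> (\<Sum>c\<in>?s ` X. DIM('a))"
    using X \<open>a \<noteq> 0\<close> by (intro sum_mono in_general_position_card_hyperplane) auto
  also have "\<dots> = card Y * DIM('a)"
    using Y by (simp add: card_image)
  finally show ?thesis using that Y by blast
qed

text \<open>Ramsey's theorem for the orientations of the projected triples yields a cup, a cap, or four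
  coplanar points.\<close>

lemma Erdos_Szekeres_3:
  "\<exists>N. \<forall>X :: (real^3) set. finite X \<and> N \<le> card X \<and> in_general_position X \<longrightarrow>
     (\<exists>Y\<subseteq>X. card Y = k \<and> in_convex_position Y)"
proof -
  \<comment> \<open>The three colours ask for a cup of \<open>k\<close> points, a cap of
    \<open>k\<close> points, or four points with collinear projections.\<close>
  obtain N :: nat where N: "partn_lst {..<N} [k,k,4] 3"
    using ramsey_full by blast
  \<comment> \<open>The factor 3 pays for keeping only points with distinct first
    coordinates.\<close>
  have "\<exists>Y\<subseteq>X. card Y = k \<and> in_convex_position Y"
    if X: "finite X" "3 * N \<le> card X" "in_general_position X" for X :: "(real^3) set"
  proof -
    let ?a = "axis 1 1 :: real^3" and ?b = "axis 2 1 :: real^3"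
    have a: "?a \<bullet> x = x $ 1" and b: "?b \<bullet> x = x $ 2" for x
      by (simp_all add: inner_axis inner_commute)
    obtain Z where Z: "Z \<subseteq> X" "inj_on (\<lambda>x. ?a \<bullet> x) Z" "card X \<le> card Z * 3"
      using in_general_position_inj_on_subset[OF X(1,3), of ?a] by auto
    have "N \<le> card Z" using Z X by simp
    then obtain g where g: "inj_on g {..<N}" "g ` {..<N} \<subseteq> Z"
      using card_le_inj[of "{..<N}" Z] finite_subset[OF Z(1) X(1)] by auto
    define f where "f T = orientation_colour (g ` T)" for T
    have "f \<in> nsets {..<N} 3 \<rightarrow> {..<length [k,k,4]}"
      by (auto simp: f_def orientation_colour_def)
    then obtain i H where i: "i < length [k,k,4]" and H: "H \<in> nsets {..<N} ([k,k,4] ! i)"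
        and fH: "f ` nsets H 3 \<subseteq> {i}"
      using N unfolding partn_lst_def monochromatic_def by blast
    define W where "W = g ` H"
    have injH: "inj_on g H" and "finite H"
      using H g(1) by (auto simp: nsets_def intro: inj_on_subset)
    have cardW: "card W = [k,k,4] ! i" and WZ: "W \<subseteq> Z" and finW: "finite W"
      using H g injH by (auto simp: W_def nsets_def card_image)
    have injW: "inj_on (\<lambda>x. ?a \<bullet> x) W"
      using Z WZ inj_on_subset by blast
    have colour: "orientation_colour {p,q,r} = i"
      if pqr: "p \<in> W" "q \<in> W" "r \<in> W" "p$1 < q$1" "q$1 < r$1" for p q r
    proof -
      obtain p' q' r' where eq: "p' \<in> H" "q' \<in> H" "r' \<in> H" "p = g p'" "q = g q'" "r = g r'"
        using pqr(1-3) by (auto simp: W_def)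
      then have "p' \<noteq> q'" "p' \<noteq> r'" "q' \<noteq> r'"
        using pqr(4,5) by auto
      then have "{p',q',r'} \<in> nsets H 3"
        using eq by (auto simp: nsets_def)
      then have "f {p',q',r'} = i" using fH by blast
      then show ?thesis by (simp add: f_def eq)
    qed
    consider "i = 0" | "i = 1" | "i = 2" using i by fastforce
    then show ?thesis
    proof cases
      case 1
      have "convex_independent W"
      proof (rule convex_independent_cup[where a = ?a and b = "?b", OF finW injW])
        fix p q r assume "p \<in> W" "q \<in> W" "r \<in> W" and lt: "?a \<bullet> p < ?a \<bullet> q" "?a \<bullet> q < ?a \<bullet> r"
        then have "orientation_colour {p,q,r} = 0"
          using colour[of p q r] 1 by (simp add: a)
        then have "(q$2 - p$2) * (r$1 - q$1) < (r$2 - q$2) * (q$1 - p$1)"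
          using order_colour_cases(1)[OF orientation_colour_eq[OF lt[unfolded a]]] by blast
        then show "((?b) \<bullet> q - (?b) \<bullet> p) * (?a \<bullet> r - ?a \<bullet> q) < ((?b) \<bullet> r - (?b) \<bullet> q) * (?a \<bullet> q - ?a \<bullet> p)"
          unfolding inner_minus_left a b by (simp add: algebra_simps)
      qed
      then show ?thesis
        using 1 cardW finW WZ Z(1) by (intro exI[of _ W]) (auto simp: in_convex_position_iff)
    next
      case 2
      \<comment> \<open>Negating the second coordinate turns a cap into a cup.\<close>
      have "convex_independent W"
      proof (rule convex_independent_cup[where a = ?a and b = "- ?b", OF finW injW])
        fix p q r assume "p \<in> W" "q \<in> W" "r \<in> W" and lt: "?a \<bullet> p < ?a \<bullet> q" "?a \<bullet> q < ?a \<bullet> r"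
        then have "orientation_colour {p,q,r} = 1"
          using colour[of p q r] 2 by (simp add: a)
        then have "(q$2 - p$2) * (r$1 - q$1) > (r$2 - q$2) * (q$1 - p$1)"
          using order_colour_cases(2)[OF orientation_colour_eq[OF lt[unfolded a]]] by blast
        then show "((- ?b) \<bullet> q - (- ?b) \<bullet> p) * (?a \<bullet> r - ?a \<bullet> q) < ((- ?b) \<bullet> r - (- ?b) \<bullet> q) * (?a \<bullet> q - ?a \<bullet> p)"
          unfolding inner_minus_left a b by (simp add: algebra_simps)
      qed
      then show ?thesis
        using 2 cardW finW WZ Z(1) by (intro exI[of _ W]) (auto simp: in_convex_position_iff)
    next
      case 3
      then have "card W = 4" using cardW by simp
      have injW1: "inj_on (\<lambda>x. x $ 1) W" using injW by (simp add: a)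
      define m where "m = arg_min_on (\<lambda>x. x $ 1) W"
      have "W \<noteq> {}" using \<open>card W = 4\<close> by auto
      then have m: "m \<in> W" "\<And>x. x \<in> W \<Longrightarrow> m $ 1 \<le> x $ 1"
        unfolding m_def using finW arg_min_if_finite[of W "\<lambda>x. x $ 1"]
        by (auto simp: not_less)
      define W' where "W' = W - {m}"
      have "card W' = 3" using \<open>card W = 4\<close> m by (simp add: W'_def)
      then have W': "W' \<noteq> {}" "finite W'" using finW W'_def by fastforce+
      define l where "l = arg_min_on (\<lambda>x. x $ 1) W'"
      have l: "l \<in> W'" "\<And>x. x \<in> W' \<Longrightarrow> l $ 1 \<le> x $ 1"
        unfolding l_def using W' arg_min_if_finite[of W' "\<lambda>x. x $ 1"]
        by (auto simp: not_less)
      have ml: "m $ 1 < l $ 1"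
        using m(2)[of l] inj_onD[OF injW1, of m l] m(1) l(1) by (fastforce simp: W'_def)
      \<comment> \<open>A normal of the plane through \<open>m\<close> and \<open>l\<close> parallel
        to the third axis. Collinearity of the projections puts all four points of \<open>W\<close>
        into it, where general position allows only three.\<close>
      define c where "c = (l$1 - m$1) *\<^sub>R ?b - (l$2 - m$2) *\<^sub>R ?a"
      have c: "c \<bullet> x = (l$1 - m$1) * x$2 - (l$2 - m$2) * x$1" for x
        by (simp add: c_def inner_diff_left a b)
      have "c \<bullet> ?b \<noteq> 0" using ml by (simp add: c axis_def)
      then have "c \<noteq> 0" by auto
      moreover have "W \<subseteq> {x. c \<bullet> x = c \<bullet> m}"
      proof
        fix x assume x: "x \<in> W"
        show "x \<in> {x. c \<bullet> x = c \<bullet> m}"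
        proof (cases "x = m \<or> x = l")
          case True
          then show ?thesis by (auto simp: c algebra_simps)
        next
          case False
          then have "x \<in> W'" "l \<in> W" using x l by (auto simp: W'_def)
          then have lx: "l $ 1 < x $ 1"
            using l(2)[of x] inj_onD[OF injW1, of l x] False x by fastforce
          have "orientation_colour {m,l,x} = 2"
            using colour[OF m(1) \<open>l \<in> W\<close> x ml lx] 3 by simp
          then have "(l$2 - m$2) * (x$1 - l$1) = (x$2 - l$2) * (l$1 - m$1)"
            using order_colour_cases(3)[OF orientation_colour_eq[OF ml lx]] by blast
          then show ?thesis by (simp add: c algebra_simps)
        qed
      qed
      ultimately have "card W \<le> 3"
        using in_general_position_card_hyperplane[OF X(3,1), of c W "c \<bullet> m"] WZ Z by simp
      then show ?thesis using \<open>card W = 4\<close> by simp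
    qed
  qed
  then show ?thesis by blast
qed

text \<open>The \<open>LEAST\<close> in \<open>ES\<close> has its defining property because some
  number has it: the one from \<open>Erdos_Szekeres_3\<close>, raised to 4 to meet the size
  condition.\<close>

lemma ES_3_property:
  fixes X :: "(real^3) set"
  shows ES_3_ge_4: "4 \<le> ES TYPE(real^3) k"
    and ES_3_convex_subset: "\<lbrakk>finite X; in_general_position X; card X = ES TYPE(real^3) k\<rbrakk> \<Longrightarrow>
      \<exists>Y\<subseteq>X. card Y = k \<and> convex_independent Y"
proof -
  let ?P = "\<lambda>N. DIM(real^3) + 1 \<le> N \<and>
     (\<forall>X::(real^3) set. finite X \<and> card X = N \<and> in_general_position X \<longrightarrow>
        (\<exists>Y. Y \<subseteq> X \<and> card Y = k \<and> in_convex_position Y))"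
  obtain N where N: "\<forall>X :: (real^3) set. finite X \<and> N \<le> card X \<and> in_general_position X \<longrightarrow>
     (\<exists>Y\<subseteq>X. card Y = k \<and> in_convex_position Y)"
    using Erdos_Szekeres_3 by blast
  have "?P (max 4 N)"
    using N by simp
  then have ES: "?P (ES TYPE(real^3) k)"
    unfolding ES_def by (rule LeastI)
  then show "4 \<le> ES TYPE(real^3) k" by simp
  assume "finite X" "in_general_position X" "card X = ES TYPE(real^3) k"
  then show "\<exists>Y\<subseteq>X. card Y = k \<and> convex_independent Y"
    using ES by (metis in_convex_position_iff)
qed

subsection \<open>Hyperplanes and sign patterns\<close>

text \<open>Induction over the hyperplanes. Adding hyperplane \<open>j\<close> splits only the
  patterns realised on both of its sides; these are also realised on the hyperplane itself, where
  the dimension is one lower. Stating the bound for affine \<open>A\<close> makes the induction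
  possible.\<close>

lemma card_sign_patterns:
  fixes \<alpha> :: "'i \<Rightarrow> 'a::euclidean_space" and \<beta> :: "'i \<Rightarrow> real"
  assumes "finite G" "affine A" "aff_dim A \<le> int d"
  shows "card ((\<lambda>x. {i \<in> G. \<alpha> i \<bullet> x < \<beta> i}) ` A) \<le> (card G + 1) ^ d"
  using assms
proof (induction G arbitrary: A d rule: finite_induct)
  case empty
  have "card ((\<lambda>x. {} :: 'i set) ` A) \<le> card {{} :: 'i set}"
    by (intro card_mono) auto
  then show ?case by simp
next
  case (insert j G)
  define pat where "pat x = {i \<in> G. \<alpha> i \<bullet> x < \<beta> i}" for x
  define pat' where "pat' x = {i \<in> insert j G. \<alpha> i \<bullet> x < \<beta> i}" for x
  have pat': "pat' x = (if \<alpha> j \<bullet> x < \<beta> j then insert j (pat x) else pat x)" for x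
    by (auto simp: pat_def pat'_def)
  have j: "j \<notin> pat x" for x
    using insert.hyps by (auto simp: pat_def)
  have fin: "finite (pat ` S)" for S
    by (rule finite_subset[of _ "Pow G"]) (auto simp: pat_def insert.hyps)
  define E where "E = pat ` {x \<in> A. \<not> \<alpha> j \<bullet> x < \<beta> j}"
  define F where "F = pat ` {x \<in> A. \<alpha> j \<bullet> x < \<beta> j}"
  have "pat' ` A = E \<union> insert j ` F"
    unfolding E_def F_def by (auto simp: pat' image_iff)
  then have "card (pat' ` A) \<le> card E + card (insert j ` F)"
    by (simp add: card_Un_le)
  also have "\<dots> \<le> card E + card F"
    using fin by (simp add: F_def card_image_le)
  also have "\<dots> = card (E \<union> F) + card (E \<inter> F)"
    using fin by (intro card_Un_Int) (auto simp: E_def F_def)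
  also have "E \<union> F = pat ` A"
    unfolding E_def F_def by blast
  finally have le: "card (pat' ` A) \<le> card (pat ` A) + card (E \<inter> F)" .
  have IH: "card (pat ` A) \<le> (card G + 1) ^ d"
    unfolding pat_def using insert by blast
  show ?case
  proof (cases "E \<inter> F = {}")
    case True
    have "card (pat' ` A) \<le> (card G + 1) ^ d"
      using le IH True by simp
    also have "\<dots> \<le> (card (insert j G) + 1) ^ d"
      using insert.hyps by (intro power_mono) auto
    finally show ?thesis by (simp add: pat'_def)
  next
    case False
    define H where "H = A \<inter> {x. \<alpha> j \<bullet> x = \<beta> j}"
    obtain x y where xy: "x \<in> A" "y \<in> A" "\<not> \<alpha> j \<bullet> x < \<beta> j" "\<alpha> j \<bullet> y < \<beta> j"
      using False unfolding E_def F_def by blast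
    have "x \<noteq> y" using xy by auto
    have A0: "0 \<le> aff_dim A"
      using aff_dim_empty[of A] aff_dim_geq[of A] xy(1) by fastforce
    have "E \<inter> F \<subseteq> pat ` H"
    proof
      fix P assume "P \<in> E \<inter> F"
      then obtain u w where u: "u \<in> A" "\<not> \<alpha> j \<bullet> u < \<beta> j" "P = pat u"
        and w: "w \<in> A" "\<alpha> j \<bullet> w < \<beta> j" "P = pat w"
        unfolding E_def F_def by blast
      \<comment> \<open>The segment from \<open>u\<close> to \<open>w\<close> meets hyperplane
        \<open>j\<close>. Both ends have pattern \<open>P\<close>, so by convexity of the
        half-spaces every point of the segment has it.\<close>
      obtain c where c: "c \<in> closed_segment u w" "\<alpha> j \<bullet> c = \<beta> j"
        using connected_ivt_hyperplane[of "closed_segment u w" w u "\<alpha> j" "\<beta> j"] u w by auto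
      have "closed_segment u w \<subseteq> {x. \<alpha> i \<bullet> x < \<beta> i}" if "i \<in> P" for i
        using that u w by (intro closed_segment_subset convex_halfspace_lt) (auto simp: pat_def)
      moreover have "closed_segment u w \<subseteq> {x. \<alpha> i \<bullet> x \<ge> \<beta> i}" if "i \<in> G - P" for i
      proof -
        have "\<beta> i \<le> \<alpha> i \<bullet> u" "\<beta> i \<le> \<alpha> i \<bullet> w"
          using that unfolding u(3) using that unfolding w(3) by (auto simp: pat_def not_less)
        then show ?thesis
          by (intro closed_segment_subset convex_halfspace_ge) auto
      qed
      ultimately have "pat c = P"
        using c(1) u(3) not_less unfolding pat_def by blast
      moreover have "c \<in> H"
        using c u w insert.prems closed_segment_subset[OF u(1) w(1) affine_imp_convex]
        by (auto simp: H_def)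
      ultimately show "P \<in> pat ` H" by blast
    qed
    then have "card (E \<inter> F) \<le> card (pat ` H)"
      using fin by (intro card_mono)
    moreover have "aff_dim H \<le> aff_dim A - 1"
    proof -
      have "\<not> A \<subseteq> {v. \<alpha> j \<bullet> v = \<beta> j}" using xy by auto
      then show ?thesis
        using aff_dim_affine_Int_hyperplane[OF insert.prems(1), of "\<alpha> j" "\<beta> j"]
        using A0 by (auto simp: H_def)
    qed
    \<comment> \<open>\<open>A\<close> has points on both sides, hence positive dimension, so the
      exponent \<open>d\<close> can be lowered.\<close>
    moreover have "aff_dim A \<noteq> 0"
      using xy \<open>x \<noteq> y\<close> by (auto simp: aff_dim_eq_0)
    ultimately obtain e where e: "d = Suc e" "aff_dim H \<le> int e"
      using insert.prems(2) A0 by (cases d) auto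
    have "affine H"
      unfolding H_def using insert.prems by (intro affine_Int affine_hyperplane)
    then have "card (pat ` H) \<le> (card G + 1) ^ e"
      unfolding pat_def using insert.IH e by blast
    then have "card (pat' ` A) \<le> (card G + 1) ^ Suc e + (card G + 1) ^ e"
      using le IH \<open>card (E \<inter> F) \<le> card (pat ` H)\<close> e by simp
    also have "\<dots> = (card G + 2) * (card G + 1) ^ e"
      by simp
    also have "\<dots> \<le> (card G + 2) * (card G + 2) ^ e"
      by (intro mult_left_mono power_mono) auto
    also have "\<dots> = (card (insert j G) + 1) ^ d"
      using insert.hyps e by simp
    finally show ?thesis by (simp add: pat'_def)
  qed
qed

text \<open>Relative to one point of \<open>B\<close>, the others give fewer than
  \<open>DIM('a)\<close> difference vectors, which span a proper subspace.\<close>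

lemma hyperplane_through_points:
  fixes B :: "'a::euclidean_space set"
  assumes "finite B" "card B \<le> DIM('a)"
  obtains a b where "a \<noteq> 0" "\<And>x. x \<in> B \<Longrightarrow> a \<bullet> x = b"
proof (cases "B = {}")
  case True
  obtain a :: 'a where "a \<noteq> 0"
    using nonzero_Basis SOME_Basis by blast
  then show ?thesis using that True by blast
next
  case False
  then obtain p where p: "p \<in> B" by blast
  define S where "S = (\<lambda>x. x - p) ` (B - {p})"
  have "card B > 0" using False assms(1) by (simp add: card_gt_0_iff)
  then have "card S < DIM('a)"
    using assms p card_image_le[of "B - {p}" "\<lambda>x. x - p"] by (simp add: S_def)
  then have "dim S < DIM('a)"
    using dim_le_card'[of S] assms(1) by (simp add: S_def)
  then obtain a where a: "a \<noteq> 0" "span S \<subseteq> {x. a \<bullet> x = 0}"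
    using lowdim_subset_hyperplane by blast
  have "a \<bullet> x = a \<bullet> p" if "x \<in> B" for x
  proof (cases "x = p")
    case False
    then have "x - p \<in> span S" using that by (intro span_base) (auto simp: S_def)
    then show ?thesis using a(2) by (auto simp: inner_diff_right)
  qed auto
  then show ?thesis using that a(1) by blast
qed

text \<open>Take a point \<open>x\<close> of \<open>X\<close> outside \<open>B\<close> and combine
  the two equations so that the result also holds at \<open>x\<close>. It then holds at
  \<open>DIM('a) + 1\<close> points of \<open>X\<close>, so it must be trivial.\<close>

lemma hyperplane_through_points_unique:
  fixes X :: "'a::euclidean_space set"
  assumes X: "finite X" "in_general_position X" and B: "B \<subseteq> X" "card B = DIM('a)"
    and 1: "a1 \<noteq> 0" "\<And>x. x \<in> B \<Longrightarrow> a1 \<bullet> x = b1"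
    and 2: "a2 \<noteq> 0" "\<And>x. x \<in> B \<Longrightarrow> a2 \<bullet> x = b2"
  obtains c where "c \<noteq> 0" "a2 = c *\<^sub>R a1" "b2 = c * b1"
proof -
  have "card B < card X"
    using X B by (auto simp: in_general_position_def)
  then obtain x where x: "x \<in> X" "x \<notin> B"
    by (metis B(1) less_irrefl subsetI subset_antisym)
  have fB: "finite B" using B X finite_subset by blast
  have no: "\<not> (\<forall>y\<in>insert x B. a \<bullet> y = b)" if "a \<noteq> 0" for a b
  proof
    assume "\<forall>y\<in>insert x B. a \<bullet> y = b"
    then have "card (insert x B) \<le> DIM('a)"
      using x B that by (intro in_general_position_card_hyperplane[OF X(2,1)]) auto
    then show False using x B fB by simp
  qed
  define k1 where "k1 = a1 \<bullet> x - b1"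
  define k2 where "k2 = a2 \<bullet> x - b2"
  have k: "k1 \<noteq> 0" "k2 \<noteq> 0"
    using no[OF 1(1), of b1] no[OF 2(1), of b2] 1 2 by (auto simp: k1_def k2_def)
  define a where "a = k1 *\<^sub>R a2 - k2 *\<^sub>R a1"
  have ay: "a \<bullet> y = k1 * b2 - k2 * b1" if "y \<in> insert x B" for y
    using that 1(2) 2(2)
    by (auto simp: a_def inner_diff_left k1_def k2_def algebra_simps)
  then have "a = 0" using no[of a "k1 * b2 - k2 * b1"] by blast
  then have "k1 * b2 - k2 * b1 = 0" using ay[of x] by simp
  moreover have "k1 *\<^sub>R a2 = k2 *\<^sub>R a1" using \<open>a = 0\<close> by (simp add: a_def)
  then have "(1 / k1) *\<^sub>R (k1 *\<^sub>R a2) = (1 / k1) *\<^sub>R (k2 *\<^sub>R a1)" by simp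
  then have "a2 = (k2 / k1) *\<^sub>R a1" using k by simp
  ultimately show ?thesis
    using k by (intro that[of "k2 / k1"]) (auto simp: field_simps)
qed

text \<open>The hyperplane cuts the hull in a face, and a face of a hull is the hull of some of the
  generating points.\<close>

lemma convex_hull_Int_supporting_hyperplane:
  fixes U :: "'a::euclidean_space set"
  assumes "finite U" "\<And>x. x \<in> U \<Longrightarrow> b \<le> a \<bullet> x" "p \<in> convex hull U" "a \<bullet> p = b"
  shows "p \<in> convex hull {x \<in> U. a \<bullet> x = b}"
proof -
  have "convex hull U \<subseteq> {x. a \<bullet> x \<ge> b}"
    using assms(2) by (intro hull_minimal) (auto simp: convex_halfspace_ge)
  then have "(convex hull U \<inter> {x. a \<bullet> x = b}) face_of (convex hull U)"
    by (intro face_of_Int_supporting_hyperplane_ge) auto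
  then obtain S where S: "S \<subseteq> U" "convex hull U \<inter> {x. a \<bullet> x = b} = convex hull S"
    using face_of_convex_hull_subset assms(1) finite_imp_compact by metis
  have "S \<subseteq> {x \<in> U. a \<bullet> x = b}"
    using S hull_subset[of S convex] by blast
  then show ?thesis
    using S(2) assms(3,4) hull_mono[of S "{x \<in> U. a \<bullet> x = b}" convex] by blast
qed

subsection \<open>The facet between a vertex and a generic point\<close>

text \<open>An arbitrary choice of equation. For \<open>DIM('a)\<close> points of a finite set in
  general position it is determined up to a nonzero factor.\<close>

definition spanning_hyperplane :: "'a::euclidean_space set \<Rightarrow> 'a \<times> real" where
  "spanning_hyperplane B = (SOME h. fst h \<noteq> 0 \<and> (\<forall>x\<in>B. fst h \<bullet> x = snd h))"

lemma spanning_hyperplane: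
  fixes B :: "'a::euclidean_space set"
  assumes "finite B" "card B \<le> DIM('a)"
  shows "fst (spanning_hyperplane B) \<noteq> 0"
    and "x \<in> B \<Longrightarrow> fst (spanning_hyperplane B) \<bullet> x = snd (spanning_hyperplane B)"
proof -
  have "\<exists>h::'a \<times> real. fst h \<noteq> 0 \<and> (\<forall>x\<in>B. fst h \<bullet> x = snd h)"
    using hyperplane_through_points[OF assms] by (metis fst_conv snd_conv)
  from someI_ex[OF this] show "fst (spanning_hyperplane B) \<noteq> 0"
    and "x \<in> B \<Longrightarrow> fst (spanning_hyperplane B) \<bullet> x = snd (spanning_hyperplane B)"
    unfolding spanning_hyperplane_def by auto
qed

text \<open>The product makes the sign relative to \<open>z\<close>: \<open>height z B q\<close> is negative iff the hyperplane
  through \<open>B\<close> strictly separates \<open>q\<close> from \<open>z\<close>, whichever equation of it was chosen.\<close>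

definition height :: "'a::euclidean_space \<Rightarrow> 'a set \<Rightarrow> 'a \<Rightarrow> real" where
  "height z B q = (fst (spanning_hyperplane B) \<bullet> z - snd (spanning_hyperplane B)) *
     (fst (spanning_hyperplane B) \<bullet> q - snd (spanning_hyperplane B))"

lemma height_affine:
  obtains a b where "\<And>q. height z B q = a \<bullet> q - b"
proof
  fix q
  let ?k = "fst (spanning_hyperplane B) \<bullet> z - snd (spanning_hyperplane B)"
  show "height z B q = (?k *\<^sub>R fst (spanning_hyperplane B)) \<bullet> q - ?k * snd (spanning_hyperplane B)"
    by (simp add: height_def right_diff_distrib)
qed

lemma convex_height_less: "convex {q. height z B q < 0}"
proof -
  obtain a b where "\<And>q. height z B q = a \<bullet> q - b" using height_affine by blast
  then show ?thesis using convex_halfspace_lt[of a b] by simp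
qed

lemma convex_height_ge: "convex {q. 0 \<le> height z B q}"
proof -
  obtain a b where "\<And>q. height z B q = a \<bullet> q - b" using height_affine by blast
  then show ?thesis using convex_halfspace_ge[of b a] by simp
qed

text \<open>Rescaling the equation by \<open>c\<close> affects both factors of
  \<open>height\<close>, so it contributes \<open>c\<^sup>2 > 0\<close>. Signs of heights can thus
  be read off from any equation.\<close>

lemma height_eq:
  fixes X :: "'a::euclidean_space set"
  assumes X: "finite X" "in_general_position X" and B: "B \<subseteq> X" "card B = DIM('a)"
    and a: "a \<noteq> 0" "\<And>x. x \<in> B \<Longrightarrow> a \<bullet> x = b"
  obtains k where "k > 0" "\<And>z q. height z B q = k * ((a \<bullet> z - b) * (a \<bullet> q - b))"
proof -
  have fB: "finite B" using B X finite_subset by blast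
  obtain c where c: "c \<noteq> 0" "fst (spanning_hyperplane B) = c *\<^sub>R a" "snd (spanning_hyperplane B) = c * b"
    using hyperplane_through_points_unique[OF X B a spanning_hyperplane(1)[OF fB]
        spanning_hyperplane(2)[OF fB]] B(2) by auto
  show ?thesis
  proof (rule that[of "c\<^sup>2"])
    show "c\<^sup>2 > 0" using c(1) by simp
    show "height z B q = c\<^sup>2 * ((a \<bullet> z - b) * (a \<bullet> q - b))" for z q
      by (simp add: height_def c(2,3) power2_eq_square algebra_simps)
  qed
qed

text \<open>The finitely many hyperplanes through \<open>DIM('a)\<close> points of \<open>X\<close>
  have measure zero and cannot cover a nonempty open set.\<close>

lemma generic_point_exists:
  fixes X :: "'a::euclidean_space set"
  assumes X: "finite X" "in_general_position X" and S: "open S" "S \<noteq> {}"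
  obtains z where "z \<in> S" "\<And>a b. \<lbrakk>a \<noteq> 0; a \<bullet> z = b\<rbrakk> \<Longrightarrow> card {x\<in>X. a \<bullet> x = b} < DIM('a)"
proof -
  let ?H = "\<lambda>B. {x. fst (spanning_hyperplane B) \<bullet> x = snd (spanning_hyperplane B)}"
  let ?\<B> = "{B. B \<subseteq> X \<and> card B = DIM('a)}"
  have fB: "finite B" if "B \<subseteq> X" for B using that X finite_subset by blast
  have "negligible (\<Union>(?H ` ?\<B>))"
  proof (rule negligible_Union)
    show "finite (?H ` ?\<B>)" using X by simp
    show "negligible T" if T: "T \<in> ?H ` ?\<B>" for T
    proof -
      obtain B where "B \<subseteq> X" "card B = DIM('a)" "T = ?H B" using T by blast
      then show ?thesis
        using spanning_hyperplane(1)[of B] fB by (auto intro!: negligible_hyperplane)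
    qed
  qed
  moreover have "\<not> negligible S" using S open_not_negligible by blast
  ultimately have "\<not> S \<subseteq> \<Union>(?H ` ?\<B>)"
    using negligible_subset by blast
  then obtain z where z: "z \<in> S" "\<And>B. B \<in> ?\<B> \<Longrightarrow> z \<notin> ?H B" by blast
  have "card {x\<in>X. a \<bullet> x = b} < DIM('a)" if ab: "a \<noteq> 0" "a \<bullet> z = b" for a b
  proof (rule ccontr)
    assume "\<not> ?thesis"
    then obtain B where B: "B \<subseteq> {x\<in>X. a \<bullet> x = b}" "card B = DIM('a)"
      using obtain_subset_with_card_n[of "DIM('a)" "{x\<in>X. a \<bullet> x = b}"] by (auto simp: not_less)
    then have BX: "B \<subseteq> X" and on: "\<And>x. x \<in> B \<Longrightarrow> a \<bullet> x = b" by auto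
    have cB: "card B \<le> DIM('a)" using B by simp
    obtain c where "c \<noteq> 0" "fst (spanning_hyperplane B) = c *\<^sub>R a" "snd (spanning_hyperplane B) = c * b"
      using hyperplane_through_points_unique[OF X BX B(2) ab(1) on
          spanning_hyperplane(1)[OF fB[OF BX] cB] spanning_hyperplane(2)[OF fB[OF BX] cB]] by blast
    then have "z \<in> ?H B" using ab by simp
    then show False using z(2) BX B(2) by blast
  qed
  then show ?thesis using that z by blast
qed

text \<open>In general position, \<open>B\<close> is the vertex set of the facet of conv
  \<open>U\<close> through which the segment from \<open>v\<close> to \<open>z\<close> enters. In
  this form the condition clearly survives deleting from \<open>U\<close> a point outside
  \<open>B\<close>.\<close>

definition separating :: "'a::euclidean_space \<Rightarrow> 'a set \<Rightarrow> 'a \<Rightarrow> 'a set \<Rightarrow> bool" where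
  "separating z U v B \<longleftrightarrow> B \<subseteq> U \<and> card B = DIM('a) \<and> height z B v < 0 \<and>
     (\<forall>x\<in>U. 0 \<le> height z B x) \<and> closed_segment v z \<inter> convex hull B \<noteq> {}"

lemma separating_remove:
  "separating z U v B \<Longrightarrow> w \<notin> B \<Longrightarrow> separating z (U - {w}) v B"
  by (auto simp: separating_def)

text \<open>Genericity keeps \<open>z\<close> off all planes spanned by \<open>X\<close>, and keeps
  segments from points of \<open>X\<close> to \<open>z\<close> away from faces of codimension at
  least two.\<close>

locale generic_point =
  fixes X :: "'a::euclidean_space set" and z :: 'a
  assumes finite_X: "finite X" and general: "in_general_position X"
    and generic: "\<And>a b. \<lbrakk>a \<noteq> 0; a \<bullet> z = b\<rbrakk> \<Longrightarrow> card {x\<in>X. a \<bullet> x = b} < DIM('a)"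
begin

text \<open>Enlarge \<open>C\<close> to \<open>DIM('a) - 1\<close> points and take a hyperplane
  through them and \<open>v\<close>. A meeting point differs from \<open>v\<close>, so the
  hyperplane contains the whole line and hence \<open>z\<close>, contradicting genericity.\<close>

lemma segment_misses_small_hull:
  assumes v: "v \<in> X" and C: "C \<subseteq> X - {v}" "card C < DIM('a)" "v \<notin> convex hull C"
  shows "closed_segment v z \<inter> convex hull C = {}"
proof (rule ccontr)
  assume "\<not> ?thesis"
  then obtain p where p: "p \<in> closed_segment v z" "p \<in> convex hull C" by blast
  have "DIM('a) + 1 \<le> card X"
    using general finite_X by (simp add: in_general_position_def)
  then have "card C \<le> DIM('a) - 1" "DIM('a) - 1 \<le> card (X - {v})"
    using C v finite_X by auto
  then obtain D where D: "C \<subseteq> D" "D \<subseteq> X - {v}" "card D = DIM('a) - 1"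
    using exists_subset_between[of C "DIM('a) - 1" "X - {v}"] C finite_X by auto
  have fD: "finite D" using D finite_X finite_subset by blast
  have "v \<notin> D" using D by blast
  then have cD: "card (insert v D) = DIM('a)"
    using D fD DIM_positive[where 'a='a] by simp
  obtain a b where ab: "a \<noteq> 0" "\<And>x. x \<in> insert v D \<Longrightarrow> a \<bullet> x = b"
    using hyperplane_through_points[of "insert v D"] fD cD by (metis finite_insert order_refl)
  have "convex hull C \<subseteq> {x. a \<bullet> x = b}"
    using ab D by (intro hull_minimal) (auto simp: convex_hyperplane)
  then have pb: "a \<bullet> p = b" using p by blast
  obtain s where s: "p = (1 - s) *\<^sub>R v + s *\<^sub>R z"
    using p(1) by (auto simp: in_segment)
  have "s \<noteq> 0" using s p C by auto
  have "b = (1 - s) * b + s * (a \<bullet> z)"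
    using pb ab(2)[of v] unfolding s by (simp add: inner_add_right)
  then have "a \<bullet> z = b" using \<open>s \<noteq> 0\<close> by (auto simp: algebra_simps)
  then have "card {x\<in>X. a \<bullet> x = b} < DIM('a)"
    using generic ab by blast
  moreover have "card (insert v D) \<le> card {x\<in>X. a \<bullet> x = b}"
    using ab D v finite_X by (intro card_mono) auto
  ultimately show False using cD by simp
qed

text \<open>The segment crosses the frontier of the hull at some \<open>p\<close>. A supporting
  hyperplane at \<open>p\<close> contains at most \<open>DIM('a)\<close> points of \<open>U\<close>
  by general position, and at least that many by \<open>segment_misses_small_hull\<close>.\<close>

lemma separating_exists:
  assumes U: "U \<subseteq> X" and v: "v \<in> X" "v \<notin> convex hull U" and z: "z \<in> interior (convex hull U)"
  obtains B where "separating z U v B"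
proof -
  have fU: "finite U" using U finite_X finite_subset by blast
  have "closed_segment v z \<inter> frontier (convex hull U) \<noteq> {}"
    using v z interior_subset by (intro connected_Int_frontier) fastforce+
  then obtain p where p: "p \<in> closed_segment v z" "p \<in> frontier (convex hull U)" by blast
  have cl: "closed (convex hull U)"
    using fU by (simp add: finite_imp_compact compact_convex_hull compact_imp_closed)
  have pU: "p \<in> convex hull U" "p \<notin> interior (convex hull U)"
    using p(2) cl by (auto simp: frontier_def)
  have ri: "rel_interior (convex hull U) = interior (convex hull U)"
    using z by (intro rel_interior_nonempty_interior) auto
  obtain a where a: "a \<noteq> 0" "\<And>y. y \<in> convex hull U \<Longrightarrow> a \<bullet> p \<le> a \<bullet> y"
      "\<And>y. y \<in> interior (convex hull U) \<Longrightarrow> a \<bullet> p < a \<bullet> y"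
    using supporting_hyperplane_rel_boundary[of "convex hull U" p] pU ri by auto
  define b where "b = a \<bullet> p"
  have az: "a \<bullet> z > b" using a(3) z by (simp add: b_def)
  obtain s where s: "p = (1 - s) *\<^sub>R v + s *\<^sub>R z" "0 \<le> s" "s \<le> 1"
    using p(1) by (auto simp: in_segment)
  have "s \<noteq> 0" using s pU v by auto
  have "s \<noteq> 1" using s pU z by auto
  \<comment> \<open>\<open>p\<close> lies strictly between \<open>v\<close> and \<open>z\<close> and
    on the supporting hyperplane, so \<open>v\<close> and \<open>z\<close> are on opposite sides of
    it.\<close>
  have "b = (1 - s) * (a \<bullet> v) + s * (a \<bullet> z)"
    unfolding b_def s(1) by (simp add: inner_add_right)
  then have "(1 - s) * (b - a \<bullet> v) = s * (a \<bullet> z - b)" by (simp add: algebra_simps)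
  moreover have "s * (a \<bullet> z - b) > 0" using az s \<open>s \<noteq> 0\<close> by simp
  ultimately have "(1 - s) * (b - a \<bullet> v) > 0" by simp
  then have av: "a \<bullet> v < b"
    using s \<open>s \<noteq> 1\<close> by (simp add: zero_less_mult_iff)
  define B where "B = {x \<in> U. a \<bullet> x = b}"
  have Uge: "b \<le> a \<bullet> x" if "x \<in> U" for x
    using a(2)[of x] that hull_inc[of x U convex] by (simp add: b_def)
  have pB: "p \<in> convex hull B"
    unfolding B_def using convex_hull_Int_supporting_hyperplane[OF fU Uge pU(1)] b_def by simp
  have BX: "B \<subseteq> X" using U by (auto simp: B_def)
  have "card B \<le> DIM('a)"
    using a(1) BX by (intro in_general_position_card_hyperplane[OF general finite_X, of a B b])
      (auto simp: B_def)
  moreover have "\<not> card B < DIM('a)"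
  proof
    assume "card B < DIM('a)"
    moreover have "convex hull B \<subseteq> convex hull U" by (intro hull_mono) (auto simp: B_def)
    moreover have "v \<notin> B" using av by (auto simp: B_def)
    ultimately have "closed_segment v z \<inter> convex hull B = {}"
      using v BX by (intro segment_misses_small_hull) auto
    then show False using p(1) pB by blast
  qed
  ultimately have cB: "card B = DIM('a)" by simp
  obtain k where k: "k > 0" "\<And>z q. height z B q = k * ((a \<bullet> z - b) * (a \<bullet> q - b))"
    using height_eq[OF finite_X general BX cB a(1), of b] by (auto simp: B_def)
  have "separating z U v B"
    unfolding separating_def
  proof (intro conjI ballI)
    show "height z B v < 0"
      using k az av by (simp add: mult_less_0_iff)
    show "0 \<le> height z B x" if "x \<in> U" for x
      using k az Uge[OF that] by simp
  qed (use cB p(1) pB in \<open>auto simp: B_def\<close>)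
  then show ?thesis using that by blast
qed

text \<open>Both facets are hit where the segment first meets conv \<open>U\<close>, hence at the
  same point. There the plane of \<open>B\<close> supports conv \<open>B'\<close>; by genericity the
  point is in no hull of fewer than \<open>DIM('a)\<close> points, so all of \<open>B'\<close> lies
  on that plane. General position then forces \<open>B = B'\<close>.\<close>

lemma separating_unique:
  assumes U: "U \<subseteq> X" and v: "v \<in> X" and B: "separating z U v B" and B': "separating z U v B'"
  shows "B = B'"
proof -
  have height0: "height z B x = 0" if "separating z U v B" "x \<in> convex hull B" for B x
  proof -
    have "B \<subseteq> X" "card B = DIM('a)" using that U by (auto simp: separating_def)
    then have "finite B" using finite_X finite_subset by blast
    obtain a b where ab: "\<And>q. height z B q = a \<bullet> q - b" using height_affine by blast
    have "height z B y = 0" if "y \<in> B" for y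
      using spanning_hyperplane(2)[OF \<open>finite B\<close> _ that] \<open>card B = _\<close> by (simp add: height_def)
    then have "convex hull B \<subseteq> {x. a \<bullet> x = b}"
      using ab by (intro hull_minimal) (auto simp: convex_hyperplane)
    then show ?thesis using that ab by auto
  qed
  have heightU: "0 \<le> height z B x" if "separating z U v B" "x \<in> convex hull U" for B x
  proof -
    have "convex hull U \<subseteq> {q. 0 \<le> height z B q}"
      using that by (intro hull_minimal convex_height_ge) (auto simp: separating_def)
    then show ?thesis using that by blast
  qed
  have hullU: "x \<in> convex hull U" if "separating z U v B" "x \<in> convex hull B" for B x
    using that hull_mono[of B U convex] by (auto simp: separating_def)
  have along: "height z B ((1 - s) *\<^sub>R v + s *\<^sub>R z) =
      height z B v + s * (height z B z - height z B v)" for B s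
  proof -
    obtain a b where ab: "\<And>q. height z B q = a \<bullet> q - b" using height_affine by blast
    show ?thesis by (simp add: ab inner_add_right algebra_simps)
  qed
  \<comment> \<open>The height over \<open>B\<close> increases strictly towards \<open>z\<close>,
    vanishes where the segment hits conv \<open>B\<close>, and is nonnegative on conv
    \<open>U\<close>, which contains conv \<open>B'\<close>.\<close>
  have first: "s \<le> s'" if "separating z U v B" "separating z U v B'"
      "(1 - s) *\<^sub>R v + s *\<^sub>R z \<in> convex hull B" "(1 - s') *\<^sub>R v + s' *\<^sub>R z \<in> convex hull B'"
      for B B' s s'
  proof (rule ccontr)
    assume "\<not> s \<le> s'"
    have "height z B z \<ge> 0" by (simp add: height_def)
    moreover have "height z B v < 0" using that by (simp add: separating_def)
    ultimately have "s' * (height z B z - height z B v) < s * (height z B z - height z B v)"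
      using \<open>\<not> s \<le> s'\<close> by (intro mult_strict_right_mono) auto
    then have "height z B ((1 - s') *\<^sub>R v + s' *\<^sub>R z) < height z B ((1 - s) *\<^sub>R v + s *\<^sub>R z)"
      by (simp add: along)
    then show False
      using height0[OF that(1,3)] heightU[OF that(1) hullU[OF that(2,4)]] by simp
  qed
  have sub: "B' \<subseteq> {x. height z B x = 0}" if B: "separating z U v B" and B': "separating z U v B'" for B B'
  proof -
    obtain p where p: "p \<in> closed_segment v z" "p \<in> convex hull B"
      using B by (auto simp: separating_def)
    obtain p' where p': "p' \<in> closed_segment v z" "p' \<in> convex hull B'"
      using B' by (auto simp: separating_def)
    obtain s s' where s: "p = (1 - s) *\<^sub>R v + s *\<^sub>R z" and s': "p' = (1 - s') *\<^sub>R v + s' *\<^sub>R z"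
      using p p' by (auto simp: in_segment)
    have "s \<le> s'" "s' \<le> s"
      using first[OF B B'] first[OF B' B] p p' s s' by auto
    then have "p' = p" using s s' by simp
    then have "height z B p' = 0" using height0 B p by blast
    obtain a b where ab: "\<And>q. height z B q = a \<bullet> q - b" using height_affine by blast
    define C where "C = {x \<in> B'. a \<bullet> x = b}"
    have B'U: "B' \<subseteq> U" "card B' = DIM('a)" using B' by (auto simp: separating_def)
    have fB': "finite B'" by (rule finite_subset[OF subset_trans[OF B'U(1) U] finite_X])
    have "p' \<in> convex hull C"
      unfolding C_def
    proof (rule convex_hull_Int_supporting_hyperplane[OF fB' _ p'(2)])
      show "b \<le> a \<bullet> x" if "x \<in> B'" for x
        using heightU[OF B hull_inc, of x] that B'U(1) ab[of x] by auto
      show "a \<bullet> p' = b" using ab[of p'] \<open>height z B p' = 0\<close> by simp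
    qed
    then have ne: "closed_segment v z \<inter> convex hull C \<noteq> {}" using p' by blast
    have "\<not> card C < DIM('a)"
    proof
      assume "card C < DIM('a)"
      moreover have "v \<notin> convex hull C"
        using heightU[OF B', of v] hullU[OF B', of v] B' hull_mono[of C B' convex]
        by (auto simp: C_def separating_def)
      moreover have "C \<subseteq> X - {v}"
        using calculation(2) hull_inc[of v C convex] B'U U by (auto simp: C_def)
      ultimately show False
        using segment_misses_small_hull[OF v] ne by blast
    qed
    then have "C = B'"
      using card_seteq[OF fB', of C] B'U(2) by (auto simp: C_def)
    then show ?thesis using ab by (auto simp: C_def)
  qed
  have BX: "B \<subseteq> X" "B' \<subseteq> X" and cB: "card B = DIM('a)" "card B' = DIM('a)"
    using B B' U by (auto simp: separating_def)
  obtain a b where ab: "\<And>q. height z B q = a \<bullet> q - b" using height_affine by blast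
  have "a \<noteq> 0"
  proof
    assume "a = 0"
    then have "height z B z = height z B v" by (simp add: ab)
    moreover have "height z B z \<ge> 0" by (simp add: height_def)
    ultimately show False using B by (simp add: separating_def)
  qed
  moreover have "B \<union> B' \<subseteq> {x. a \<bullet> x = b}"
    using sub[OF B B] sub[OF B B'] ab by auto
  ultimately have "card (B \<union> B') \<le> DIM('a)"
    using BX by (intro in_general_position_card_hyperplane[OF general finite_X, of a _ b]) auto
  moreover have "finite (B \<union> B')" by (rule finite_subset[OF Un_least[OF BX] finite_X])
  ultimately show ?thesis
    using cB card_seteq[of "B \<union> B'" B] card_seteq[of "B \<union> B'" B'] by auto
qed

end

subsection \<open>Cells of vertices\<close>

text \<open>The average indegree is at most \<open>d\<close>, so some vertex has indegree at most
  \<open>d\<close>. Select it, discard it together with its at most \<open>2 * d\<close> neighbours,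
  and repeat.\<close>

lemma outdegree_independent_set:
  fixes L :: "'a set" and f :: "'a \<Rightarrow> 'a set"
  assumes "finite L" "\<And>v. v \<in> L \<Longrightarrow> finite (f v) \<and> card (f v) \<le> d" "(2 * d + 1) * m < card L"
  shows "\<exists>T\<subseteq>L. card T = Suc m \<and> (\<forall>i\<in>T. \<forall>j\<in>T. i \<noteq> j \<longrightarrow> j \<notin> f i)"
  using assms
proof (induction m arbitrary: L)
  case 0
  then obtain v where "v \<in> L" by fastforce
  then show ?case by (intro exI[of _ "{v}"]) auto
next
  case (Suc m)
  define In where "In v = {u\<in>L. v \<in> f u}" for v
  have count: "card {u\<in>L. P u} = (\<Sum>u\<in>L. if P u then 1 else 0)" for P
    using Suc.prems(1) by (simp add: sum.If_cases Int_def)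
  have "\<exists>v\<in>L. card (In v) \<le> d"
  proof (rule ccontr)
    assume "\<not> ?thesis"
    then have "(\<Sum>v\<in>L. Suc d) \<le> (\<Sum>v\<in>L. card (In v))"
      by (intro sum_mono) (auto simp: not_le Suc_le_eq)
    also have "\<dots> = (\<Sum>v\<in>L. \<Sum>u\<in>L. if v \<in> f u then 1 else 0)"
      by (simp add: In_def count)
    also have "\<dots> = (\<Sum>u\<in>L. \<Sum>v\<in>L. if v \<in> f u then 1 else 0)"
      by (rule sum.swap)
    also have "\<dots> = (\<Sum>u\<in>L. card {v\<in>L. v \<in> f u})"
      by (simp add: count)
    also have "\<dots> \<le> (\<Sum>u\<in>L. d)"
    proof (rule sum_mono)
      fix u assume "u \<in> L"
      then have "card {v\<in>L. v \<in> f u} \<le> card (f u)"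
        using Suc.prems(2) by (intro card_mono) auto
      then show "card {v\<in>L. v \<in> f u} \<le> d"
        using Suc.prems(2)[OF \<open>u \<in> L\<close>] by simp
    qed
    also have "\<dots> = card L * d" by simp
    finally show False using Suc.prems(3) by auto
  qed
  then obtain v where v: "v \<in> L" "card (In v) \<le> d" by blast
  define R where "R = insert v (f v \<union> In v)"
  have fR: "finite R" using Suc.prems v by (auto simp: R_def In_def)
  have "card R \<le> Suc (card (f v \<union> In v))"
    unfolding R_def by (metis card.infinite card_insert_if finite_insert le_SucI order_refl)
  also have "\<dots> \<le> 2 * d + 1"
    using card_Un_le[of "f v" "In v"] v Suc.prems(2)[of v] by simp
  finally have "card R \<le> 2 * d + 1" .
  moreover have "card L - card R \<le> card (L - R)"
    using fR by (rule diff_card_le_card_Diff)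
  ultimately have "(2 * d + 1) * m < card (L - R)"
    using Suc.prems(3) by simp
  then obtain T where T: "T \<subseteq> L - R" "card T = Suc m" "\<forall>i\<in>T. \<forall>j\<in>T. i \<noteq> j \<longrightarrow> j \<notin> f i"
    using Suc.IH[of "L - R"] Suc.prems by auto
  have "v \<notin> T" "finite T"
    using T(1) Suc.prems(1) finite_subset[of T L] by (auto simp: R_def)
  moreover have "\<forall>i\<in>T. i \<notin> f v \<and> v \<notin> f i"
    using T(1) by (auto simp: R_def In_def)
  ultimately show ?case
    using T v by (intro exI[of _ "insert v T"]) auto
qed

text \<open>The set argument is what remains after removing \<open>v\<close>, so it is usually of
  the form \<open>W - {v}\<close>. The description is meaningful only when a separating
  \<open>B\<close> exists.\<close>

definition facet_towards :: "'a::euclidean_space \<Rightarrow> 'a set \<Rightarrow> 'a \<Rightarrow> 'a set" where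
  "facet_towards z W v = (THE B. separating z W v B)"

text \<open>Only one plane for each vertex, rather than all facet planes: this keeps the number of
  sign patterns polynomial of degree \<open>DIM('a)\<close> in the size of \<open>W\<close>.\<close>

definition vertex_facets :: "'a::euclidean_space \<Rightarrow> 'a set \<Rightarrow> 'a set set" where
  "vertex_facets z W = {B. \<exists>u\<in>W. separating z (W - {u}) u B}"

text \<open>The sign pattern of \<open>q\<close> in the arrangement of these planes; a point on a
  plane counts as not separated from \<open>z\<close>.\<close>

definition sees :: "'a::euclidean_space \<Rightarrow> 'a set \<Rightarrow> 'a \<Rightarrow> 'a set set" where
  "sees z W q = {B \<in> vertex_facets z W. height z B q < 0}"

text \<open>Here \<open>W\<close> is the set without \<open>v\<close>. The facet condition is
  separate because that facet has all of \<open>W\<close> on the side of \<open>z\<close>, whereas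
  each member of \<open>vertex_facets z W\<close> cuts off a point of \<open>W\<close>.\<close>

definition cell :: "'a::euclidean_space \<Rightarrow> 'a set \<Rightarrow> 'a set \<Rightarrow> 'a \<Rightarrow> 'a set" where
  "cell z X W v = {q\<in>X. sees z W q = sees z W v \<and> height z (facet_towards z W v) q < 0}"

context generic_point
begin

lemma separating_facet_towards:
  assumes "W \<subseteq> X" "v \<in> X" "separating z W v B"
  shows "facet_towards z W v = B"
  unfolding facet_towards_def
  by (rule the_equality, rule assms(3)) (rule separating_unique[OF assms(1,2) _ assms(3)])

lemma card_vertex_facets:
  assumes W: "W \<subseteq> X"
  shows "finite (vertex_facets z W)" "card (vertex_facets z W) \<le> card W"
proof -
  have sub: "vertex_facets z W \<subseteq> (\<lambda>u. facet_towards z (W - {u}) u) ` W"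
  proof
    fix B assume "B \<in> vertex_facets z W"
    then obtain u where u: "u \<in> W" "separating z (W - {u}) u B"
      by (auto simp: vertex_facets_def)
    then have "facet_towards z (W - {u}) u = B"
      using W by (intro separating_facet_towards) auto
    then show "B \<in> (\<lambda>u. facet_towards z (W - {u}) u) ` W" using u(1) by blast
  qed
  have fW: "finite W" by (rule finite_subset[OF W finite_X])
  show "finite (vertex_facets z W)" using sub fW finite_surj by blast
  show "card (vertex_facets z W) \<le> card W" using surj_card_le[OF fW sub] .
qed

lemma card_sees:
  assumes W: "W \<subseteq> X"
  shows "card (range (sees z W)) \<le> (card W + 1) ^ DIM('a)"
proof -
  \<comment> \<open>Choosing an affine form for every \<open>B\<close> brings \<open>sees\<close>
    into the shape of \<open>card_sign_patterns\<close>.\<close>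
  have "\<forall>B. \<exists>ab. \<forall>q. height z B q = fst ab \<bullet> q - snd ab"
    using height_affine by (metis fst_conv snd_conv)
  then obtain h where h: "\<And>B q. height z B q = fst (h B) \<bullet> q - snd (h B)" by metis
  have "card (range (sees z W)) =
      card ((\<lambda>x. {B \<in> vertex_facets z W. fst (h B) \<bullet> x < snd (h B)}) ` UNIV)"
    by (simp add: sees_def[abs_def] h)
  also have "\<dots> \<le> (card (vertex_facets z W) + 1) ^ DIM('a)"
    by (intro card_sign_patterns card_vertex_facets W) (auto simp: aff_dim_UNIV)
  also have "\<dots> \<le> (card W + 1) ^ DIM('a)"
    using card_vertex_facets[OF W] by (intro power_mono) auto
  finally show ?thesis .
qed

text \<open>A cell is determined by a label, the pattern and the facet, and all points of
  \<open>S\<close> with one label lie in a common cell of fewer than \<open>\<epsilon>\<close>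
  points. It remains to count labels.\<close>

lemma card_small_cells:
  assumes W: "W \<subseteq> X" and "0 \<le> \<epsilon>"
  shows "real (card {v\<in>X. (\<exists>B. separating z W v B) \<and> real (card (cell z X W v)) < \<epsilon>})
    \<le> real ((card W + 1) ^ DIM('a) * card W ^ DIM('a)) * \<epsilon>"
proof -
  define S where "S = {v\<in>X. (\<exists>B. separating z W v B) \<and> real (card (cell z X W v)) < \<epsilon>}"
  define label where "label v = (sees z W v, facet_towards z W v)" for v
  have fS: "finite S" using finite_X by (simp add: S_def)
  have fW: "finite W" by (rule finite_subset[OF W finite_X])
  have sep: "separating z W v (facet_towards z W v)" if "v \<in> S" for v
    using that separating_facet_towards[OF W] by (auto simp: S_def)
  have fsees: "finite (range (sees z W))"
    by (rule finite_subset[of _ "Pow (vertex_facets z W)"])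
      (auto simp: sees_def card_vertex_facets W)
  have "label ` S \<subseteq> range (sees z W) \<times> {B. B \<subseteq> W \<and> card B = DIM('a)}"
    using sep by (auto simp: label_def separating_def)
  then have "card (label ` S) \<le> card (range (sees z W) \<times> {B. B \<subseteq> W \<and> card B = DIM('a)})"
    using fsees fW by (intro card_mono) auto
  also have "\<dots> = card (range (sees z W)) * (card W choose DIM('a))"
    by (simp add: card_cartesian_product n_subsets[OF fW])
  also have "\<dots> \<le> (card W + 1) ^ DIM('a) * card W ^ DIM('a)"
  proof (intro mult_mono card_sees[OF W])
    have "(card W choose DIM('a)) * 1 \<le> (card W choose DIM('a)) * fact DIM('a)"
      by (intro mult_left_mono fact_ge_1) simp
    then show "card W choose DIM('a) \<le> card W ^ DIM('a)"
      using binomial_fact_pow[of "card W" "DIM('a)"] by linarith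
  qed auto
  finally have labels: "card (label ` S) \<le> (card W + 1) ^ DIM('a) * card W ^ DIM('a)" .
  have fibre: "real (card {v\<in>S. label v = l}) \<le> \<epsilon>" if l: "l \<in> label ` S" for l
  proof -
    obtain v where v: "v \<in> S" "l = label v" using l by blast
    have "{w\<in>S. label w = l} \<subseteq> cell z X W v"
    proof
      fix w assume "w \<in> {w\<in>S. label w = l}"
      then have w: "w \<in> S" "sees z W w = sees z W v" "facet_towards z W w = facet_towards z W v"
        using v by (auto simp: label_def)
      have "height z (facet_towards z W v) w < 0"
        using sep[OF w(1)] w(3) by (simp add: separating_def)
      then show "w \<in> cell z X W v"
        using w by (simp add: cell_def S_def)
    qed
    then have "card {w\<in>S. label w = l} \<le> card (cell z X W v)"
      using finite_X by (intro card_mono) (auto simp: cell_def)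
    then show ?thesis using v(1) by (simp add: S_def)
  qed
  have "card S = card (\<Union>l\<in>label ` S. {v\<in>S. label v = l})"
    by (rule arg_cong[of _ _ card]) auto
  also have "\<dots> \<le> (\<Sum>l\<in>label ` S. card {v\<in>S. label v = l})"
    using fS by (intro card_UN_le) auto
  finally have "real (card S) \<le> real (\<Sum>l\<in>label ` S. card {v\<in>S. label v = l})"
    by (rule of_nat_mono)
  also have "\<dots> = (\<Sum>l\<in>label ` S. real (card {v\<in>S. label v = l}))"
    by (rule of_nat_sum)
  also have "\<dots> \<le> (\<Sum>l\<in>label ` S. \<epsilon>)"
    by (intro sum_mono fibre)
  also have "\<dots> = real (card (label ` S)) * \<epsilon>" by simp
  also have "\<dots> \<le> real ((card W + 1) ^ DIM('a) * card W ^ DIM('a)) * \<epsilon>"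
    using labels \<open>0 \<le> \<epsilon>\<close> by (intro mult_right_mono) (simp_all only: of_nat_le_iff)
  finally show ?thesis by (simp add: S_def)
qed

text \<open>Since \<open>A\<close> survives the removal of \<open>v\<close>, the point
  \<open>z\<close> stays interior to the hull.\<close>

lemma separating_vertex:
  assumes W: "W \<subseteq> X" "convex_independent W" and A: "A \<subseteq> W" "z \<in> interior (convex hull A)"
    and v: "v \<in> W - A"
  shows "separating z (W - {v}) v (facet_towards z (W - {v}) v)"
proof -
  have "convex hull A \<subseteq> convex hull (W - {v})"
    using A v by (intro hull_mono) auto
  then have "z \<in> interior (convex hull (W - {v}))"
    using A interior_mono by blast
  moreover have "v \<notin> convex hull (W - {v})"
    using W v by (auto simp: convex_independent_def)
  ultimately obtain B where "separating z (W - {v}) v B"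
    using separating_exists[of "W - {v}" v] W v by blast
  then show ?thesis
    using separating_facet_towards[of "W - {v}" v B] W v by auto
qed

text \<open>The facet \<open>B\<close> of \<open>i\<close> avoids \<open>j\<close>, so it still
  separates \<open>i\<close> after deleting \<open>j\<close> and belongs to
  \<open>vertex_facets z (W - {j})\<close>. The side of \<open>B\<close> is therefore constant on
  the cell of \<open>j\<close>, and it is the side of \<open>j\<close>, opposite to the cell of
  \<open>i\<close>.\<close>

lemma cells_in_convex_position:
  assumes W: "W \<subseteq> X" "convex_independent W" and A: "A \<subseteq> W" "z \<in> interior (convex hull A)"
    and T: "T \<subseteq> W - A" "\<And>i j. \<lbrakk>i \<in> T; j \<in> T; i \<noteq> j\<rbrakk> \<Longrightarrow> j \<notin> facet_towards z (W - {i}) i"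
  shows "family_in_convex_position T (\<lambda>i. cell z X (W - {i}) i)"
  unfolding family_in_convex_position_def
proof
  fix i assume i: "i \<in> T"
  define B where "B = facet_towards z (W - {i}) i"
  have sep: "separating z (W - {i}) i B"
    unfolding B_def using separating_vertex[OF W A] T(1) i by blast
  have "convex hull (cell z X (W - {i}) i) \<subseteq> {q. height z B q < 0}"
    by (intro hull_minimal convex_height_less) (auto simp: cell_def B_def)
  moreover have "convex hull (\<Union>j\<in>T - {i}. cell z X (W - {j}) j) \<subseteq> {q. 0 \<le> height z B q}"
  proof (intro hull_minimal convex_height_ge UN_least subsetI)
    fix j q assume j: "j \<in> T - {i}" and q: "q \<in> cell z X (W - {j}) j"
    have "separating z (W - {i} - {j}) i B"
      using separating_remove[OF sep] T(2) i j by (auto simp: B_def)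
    moreover have "W - {i} - {j} = W - {j} - {i}" by blast
    ultimately have mem: "B \<in> vertex_facets z (W - {j})"
      using i j T(1) by (auto simp: vertex_facets_def)
    have "0 \<le> height z B j"
      using sep i j T(1) by (auto simp: separating_def)
    then have "B \<notin> sees z (W - {j}) j" by (simp add: sees_def)
    then have "B \<notin> sees z (W - {j}) q" using q by (simp add: cell_def)
    then show "q \<in> {q. 0 \<le> height z B q}" using mem by (simp add: sees_def)
  qed
  ultimately show "convex hull (cell z X (W - {i}) i) \<inter>
      convex hull (\<Union>j\<in>T - {i}. cell z X (W - {j}) j) = {}"
    by fastforce
qed

text \<open>Apply \<open>outdegree_independent_set\<close> to the digraph joining each vertex
  outside \<open>A\<close> to the \<open>DIM('a)\<close> points of its facet.\<close>

lemma large_cells_family: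
  assumes W: "W \<subseteq> X" "convex_independent W" and A: "A \<subseteq> W" "z \<in> interior (convex hull A)"
    and card: "card A + (2 * DIM('a) + 1) * m < card W"
    and large: "\<And>v. v \<in> W - A \<Longrightarrow> \<epsilon> \<le> real (card (cell z X (W - {v}) v))"
  shows "\<exists>T (F :: 'a \<Rightarrow> 'a set). card T = Suc m \<and> family_in_convex_position T F \<and>
    (\<forall>i\<in>T. F i \<subseteq> X \<and> \<epsilon> \<le> real (card (F i)))"
proof -
  have fW: "finite W" by (rule finite_subset[OF W(1) finite_X])
  have "finite (facet_towards z (W - {v}) v) \<and> card (facet_towards z (W - {v}) v) \<le> DIM('a)"
    if "v \<in> W - A" for v
    using separating_vertex[OF W A that] fW finite_subset[of _ W] by (auto simp: separating_def)
  moreover have "(2 * DIM('a) + 1) * m < card (W - A)"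
    using card A(1) fW by (simp add: card_Diff_subset finite_subset)
  ultimately obtain T where T: "T \<subseteq> W - A" "card T = Suc m"
      "\<forall>i\<in>T. \<forall>j\<in>T. i \<noteq> j \<longrightarrow> j \<notin> facet_towards z (W - {i}) i"
    using outdegree_independent_set[of "W - A" "\<lambda>v. facet_towards z (W - {v}) v" "DIM('a)" m] fW
    by auto
  moreover have "family_in_convex_position T (\<lambda>i. cell z X (W - {i}) i)"
    using T by (intro cells_in_convex_position[OF W A]) auto
  ultimately show ?thesis
    using large by (intro exI[of _ T] exI[of _ "\<lambda>i. cell z X (W - {i}) i"]) (auto simp: cell_def)
qed

end

subsection \<open>Counting\<close>

lemma generic_point_in_simplex:
  fixes X :: "'a::euclidean_space set"
  assumes X: "finite X" "in_general_position X" and A: "A \<subseteq> X" "card A = DIM('a) + 1"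
  obtains z where "generic_point X z" "z \<in> interior (convex hull A)"
proof -
  have "interior (convex hull A) \<noteq> {}"
  proof
    assume "interior (convex hull A) = {}"
    then obtain a b where ab: "a \<noteq> 0" "convex hull A \<subseteq> {x. a \<bullet> x = b}"
      using empty_interior_subset_hyperplane[of "convex hull A"] by auto
    then have "A \<subseteq> {x. a \<bullet> x = b}" using hull_subset[of A convex] by blast
    then have "card A \<le> DIM('a)"
      using in_general_position_card_hyperplane[OF X(2,1) ab(1) A(1)] by blast
    then show False using A by simp
  qed
  then obtain z where "z \<in> interior (convex hull A)"
      "\<And>a b. \<lbrakk>a \<noteq> 0; a \<bullet> z = b\<rbrakk> \<Longrightarrow> card {x\<in>X. a \<bullet> x = b} < DIM('a)"
    using generic_point_exists[OF X open_interior] by blast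
  then show ?thesis
    using that[of z] X by (auto simp: generic_point_def)
qed

text \<open>Double counting of pairs \<open>Y \<subseteq> Z\<close>: each \<open>N\<close>-set
  contains a good \<open>Y\<close>, and each \<open>Y\<close> lies in at most
  \<open>(card X - k) choose (N - k)\<close> of the \<open>N\<close>-sets.\<close>

lemma card_subsets_supersaturation:
  assumes X: "finite X" "N \<le> card X"
    and contains: "\<And>Z. \<lbrakk>Z \<subseteq> X; card Z = N\<rbrakk> \<Longrightarrow> \<exists>Y\<subseteq>Z. card Y = k \<and> P Y"
  shows "(card X choose k) \<le> (N choose k) * card {Y. Y \<subseteq> X \<and> card Y = k \<and> P Y}"
proof -
  let ?\<Y> = "{Y. Y \<subseteq> X \<and> card Y = k \<and> P Y}"
  let ?\<Z> = "{Z. Z \<subseteq> X \<and> card Z = N}"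
  have fin: "finite Y" if "Y \<subseteq> X" for Y using that X finite_subset by blast
  have f\<Y>: "finite ?\<Y>" using X by simp
  obtain Z where Z: "Z \<subseteq> X" "card Z = N" using X by (metis obtain_subset_with_card_n)
  then obtain Y where "Y \<subseteq> Z" "card Y = k" using contains by blast
  then have kN: "k \<le> N" using Z fin card_mono by blast
  have super: "card {Z\<in>?\<Z>. Y \<subseteq> Z} \<le> (card X - k) choose (N - k)" if Y: "Y \<in> ?\<Y>" for Y
  proof -
    have "card {Z\<in>?\<Z>. Y \<subseteq> Z} \<le> card {S. S \<subseteq> X - Y \<and> card S = N - k}"
    proof (rule card_inj_on_le[where f = "\<lambda>Z. Z - Y"])
      show "inj_on (\<lambda>Z. Z - Y) {Z\<in>?\<Z>. Y \<subseteq> Z}"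
        by (rule inj_onI) blast
      show "(\<lambda>Z. Z - Y) ` {Z\<in>?\<Z>. Y \<subseteq> Z} \<subseteq> {S. S \<subseteq> X - Y \<and> card S = N - k}"
        using Y fin by (auto simp: card_Diff_subset)
    qed (use X in auto)
    also have "\<dots> = (card X - k) choose (N - k)"
      using Y X fin by (simp add: n_subsets card_Diff_subset)
    finally show ?thesis .
  qed
  have "?\<Z> \<subseteq> (\<Union>Y\<in>?\<Y>. {Z\<in>?\<Z>. Y \<subseteq> Z})"
  proof
    fix Z assume Z: "Z \<in> ?\<Z>"
    then obtain Y where "Y \<subseteq> Z" "card Y = k" "P Y" using contains[of Z] by auto
    then show "Z \<in> (\<Union>Y\<in>?\<Y>. {Z\<in>?\<Z>. Y \<subseteq> Z})"
      using Z by (intro UN_I[of Y]) auto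
  qed
  then have "card ?\<Z> \<le> card (\<Union>Y\<in>?\<Y>. {Z\<in>?\<Z>. Y \<subseteq> Z})"
    using X f\<Y> by (intro card_mono) auto
  also have "\<dots> \<le> (\<Sum>Y\<in>?\<Y>. card {Z\<in>?\<Z>. Y \<subseteq> Z})"
    by (intro card_UN_le f\<Y>)
  also have "\<dots> \<le> (\<Sum>Y\<in>?\<Y>. (card X - k) choose (N - k))"
    by (intro sum_mono super)
  finally have "card X choose N \<le> card ?\<Y> * ((card X - k) choose (N - k))"
    using X by (simp add: n_subsets)
  then have "(card X choose N) * (N choose k) \<le> card ?\<Y> * ((card X - k) choose (N - k)) * (N choose k)"
    by (rule mult_right_mono) simp
  then have "(card X choose k) * ((card X - k) choose (N - k)) \<le>
      ((N choose k) * card ?\<Y>) * ((card X - k) choose (N - k))"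
    unfolding choose_mult[OF kN X(2)] by (simp only: mult_ac)
  moreover have "(card X - k) choose (N - k) > 0"
    using kN X by (simp add: zero_less_binomial_iff)
  ultimately show ?thesis by simp
qed

text \<open>The root \<open>A\<close> spans the simplex around \<open>z\<close> and is never
  removed, so the same \<open>z\<close> serves for the whole succession of deletions.\<close>

definition rooted_convex_sets :: "'a::euclidean_space set \<Rightarrow> nat \<Rightarrow> ('a set \<times> 'a set) set" where
  "rooted_convex_sets X k =
     {(A, W). A \<subseteq> W \<and> W \<subseteq> X \<and> card A = DIM('a) + 1 \<and> card W = k \<and> convex_independent W}"

lemma finite_rooted_convex_sets: "finite X \<Longrightarrow> finite (rooted_convex_sets X k)"
  by (rule finite_subset[of _ "Pow X \<times> Pow X"]) (auto simp: rooted_convex_sets_def)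

text \<open>If no family of large cells is in convex position, every large rooted convex set has a
  vertex in a small cell, and deleting it can be undone in few ways.\<close>

lemma card_rooted_convex_sets_Suc:
  fixes X :: "'a::euclidean_space set"
  assumes X: "finite X" "in_general_position X" and "0 \<le> \<epsilon>"
    and none: "\<nexists>T (F :: 'a \<Rightarrow> 'a set). card T = Suc m \<and> family_in_convex_position T F \<and>
       (\<forall>i\<in>T. F i \<subseteq> X \<and> \<epsilon> \<le> real (card (F i)))"
    and k: "DIM('a) + 1 + (2 * DIM('a) + 1) * m < Suc k"
  shows "real (card (rooted_convex_sets X (Suc k))) \<le>
    real (card (rooted_convex_sets X k)) * (real ((k + 1) ^ DIM('a) * k ^ DIM('a)) * \<epsilon>)"
proof -
  \<comment> \<open>The centre depends on \<open>A\<close> only; it can be recovered after a vertex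
    of \<open>W\<close> has been deleted.\<close>
  define centre where
    "centre A = (SOME z. generic_point X z \<and> z \<in> interior (convex hull A))" for A
  have centre: "generic_point X (centre A)" "centre A \<in> interior (convex hull A)"
    if "A \<subseteq> X" "card A = DIM('a) + 1" for A
    unfolding centre_def using generic_point_in_simplex[OF X that]
    by (metis (mono_tags, lifting) someI_ex)+
  \<comment> \<open>The candidates for the deleted vertex, described by what is left after the
    deletion.\<close>
  define Small where "Small = (\<lambda>(A, W). {v\<in>X. (\<exists>B. separating (centre A) W v B) \<and>
    real (card (cell (centre A) X W v)) < \<epsilon>})"
  have fS: "finite (Small p)" for p using X by (cases p) (simp add: Small_def)
  have small: "real (card (Small p)) \<le> real ((k + 1) ^ DIM('a) * k ^ DIM('a)) * \<epsilon>"
    if "p \<in> rooted_convex_sets X k" for p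
  proof -
    obtain A W where p: "p = (A, W)" by (cases p)
    have AW: "A \<subseteq> X" "card A = DIM('a) + 1" "W \<subseteq> X" "card W = k"
      using that by (auto simp: p rooted_convex_sets_def)
    interpret generic_point X "centre A" using centre AW by blast
    show ?thesis
      using card_small_cells[OF AW(3) \<open>0 \<le> \<epsilon>\<close>] by (simp add: p Small_def AW(4))
  qed
  have "rooted_convex_sets X (Suc k) \<subseteq>
      (\<lambda>((A, W), v). (A, insert v W)) ` Sigma (rooted_convex_sets X k) Small"
  proof
    fix p assume "p \<in> rooted_convex_sets X (Suc k)"
    then obtain A W where p: "p = (A, W)" and AW: "A \<subseteq> W" "W \<subseteq> X" "card A = DIM('a) + 1"
        "card W = Suc k" "convex_independent W"
      by (auto simp: rooted_convex_sets_def)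
    have AX: "A \<subseteq> X" using AW by blast
    interpret generic_point X "centre A" using centre[OF AX AW(3)] by blast
    have c: "centre A \<in> interior (convex hull A)" using centre[OF AX AW(3)] by blast
    have "\<exists>v\<in>W - A. real (card (cell (centre A) X (W - {v}) v)) < \<epsilon>"
    proof (rule ccontr)
      assume "\<not> ?thesis"
      then have "\<epsilon> \<le> real (card (cell (centre A) X (W - {v}) v))" if "v \<in> W - A" for v
        using that by (auto simp: not_less)
      then show False
        using large_cells_family[OF AW(2,5,1) c, of m \<epsilon>] k none unfolding AW(3,4) by blast
    qed
    then obtain v where v: "v \<in> W - A" "real (card (cell (centre A) X (W - {v}) v)) < \<epsilon>"
      by blast
    have "(A, W - {v}) \<in> rooted_convex_sets X k"
      using AW v convex_independent_subset[OF AW(5)] by (auto simp: rooted_convex_sets_def)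
    moreover have "v \<in> Small (A, W - {v})"
      using separating_vertex[OF AW(2,5,1) c v(1)] v AW(2) by (auto simp: Small_def)
    moreover have "p = (\<lambda>((A, W), v). (A, insert v W)) ((A, W - {v}), v)"
      using v p by auto
    ultimately show "p \<in> (\<lambda>((A, W), v). (A, insert v W)) ` Sigma (rooted_convex_sets X k) Small"
      by blast
  qed
  then have "card (rooted_convex_sets X (Suc k)) \<le> card (Sigma (rooted_convex_sets X k) Small)"
    using finite_rooted_convex_sets[OF X(1)] fS by (intro surj_card_le) auto
  also have "\<dots> = (\<Sum>p\<in>rooted_convex_sets X k. card (Small p))"
    using finite_rooted_convex_sets[OF X(1)] fS by (intro card_SigmaI) auto
  finally have "real (card (rooted_convex_sets X (Suc k))) \<le>
      real (\<Sum>p\<in>rooted_convex_sets X k. card (Small p))"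
    by (rule of_nat_mono)
  also have "\<dots> = (\<Sum>p\<in>rooted_convex_sets X k. real (card (Small p)))"
    by (rule of_nat_sum)
  also have "\<dots> \<le> (\<Sum>p\<in>rooted_convex_sets X k. real ((k + 1) ^ DIM('a) * k ^ DIM('a)) * \<epsilon>)"
    by (intro sum_mono small)
  finally show ?thesis by simp
qed

section \<open>Iterating the count and comparing it with factorials\<close>

lemma fact_eventually_gt_power:
  fixes c :: real
  shows "\<exists>n0>0. \<forall>n\<ge>n0. c ^ n < fact n"
proof -
  have "(\<lambda>n. inverse (fact n) * c ^ n) \<longlonglongrightarrow> 0"
    by (rule summable_LIMSEQ_zero[OF summable_exp])
  then have "eventually (\<lambda>n. inverse (fact n) * c ^ n < 1) sequentially"
    by (rule order_tendstoD) simp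
  then obtain n0 where n0: "\<And>n. n \<ge> n0 \<Longrightarrow> inverse (fact n) * c ^ n < 1"
    by (auto simp: eventually_sequentially)
  \<comment> \<open>The successor makes the threshold positive.\<close>
  have "c ^ n < fact n" if "n \<ge> Suc n0" for n
    using n0[of n] that by (simp add: field_simps)
  then show ?thesis by blast
qed

lemma fact_mult_power_le_fact_add: "fact n * n ^ k \<le> (fact (n + k) :: nat)"
proof (induction k)
  case (Suc k)
  have "fact n * n ^ Suc k = n * (fact n * n ^ k)" by simp
  also have "\<dots> \<le> (n + Suc k) * fact (n + k)"
    using Suc by (intro mult_mono) auto
  finally show ?case by simp
qed simp

lemma card_rooted_convex_sets_le:
  fixes X :: "'a::euclidean_space set"
  assumes "finite X"
  shows "card (rooted_convex_sets X k) \<le> (card X choose k) * 2 ^ k"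
proof -
  let ?\<W> = "{W. W \<subseteq> X \<and> card W = k}"
  have fin: "finite W" if "W \<in> ?\<W>" for W using that assms finite_subset by blast
  have f\<W>: "finite ?\<W>" using assms by simp
  have fPow: "\<forall>W\<in>?\<W>. finite (Pow W)" using fin by (metis finite_Pow_iff)
  have "rooted_convex_sets X k \<subseteq> (\<lambda>(W, A). (A, W)) ` (SIGMA W:?\<W>. Pow W)"
    by (auto simp: rooted_convex_sets_def)
  then have "card (rooted_convex_sets X k) \<le> card (SIGMA W:?\<W>. Pow W)"
    using finite_SigmaI[OF f\<W>, of Pow] fPow by (intro surj_card_le) blast+
  also have "\<dots> = (\<Sum>W\<in>?\<W>. card (Pow W))"
    using f\<W> fPow by (rule card_SigmaI)
  also have "\<dots> = (\<Sum>W\<in>?\<W>. 2 ^ k)"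
  proof (rule sum.cong[OF refl])
    fix W assume W: "W \<in> ?\<W>"
    then show "card (Pow W) = 2 ^ k" using card_Pow[OF fin[OF W]] by simp
  qed
  also have "\<dots> = (card X choose k) * 2 ^ k"
    using assms by (simp add: n_subsets)
  finally show ?thesis .
qed

text \<open>Iterates \<open>card_rooted_convex_sets_Suc\<close>, replacing the factor of each step
  by one that depends on the upper limit \<open>l\<close> alone.\<close>

lemma card_rooted_convex_sets_add:
  fixes X :: "'a::euclidean_space set"
  assumes X: "finite X" "in_general_position X" and "0 \<le> \<epsilon>"
    and none: "\<nexists>T (F :: 'a \<Rightarrow> 'a set). card T = Suc m \<and> family_in_convex_position T F \<and>
       (\<forall>i\<in>T. F i \<subseteq> X \<and> \<epsilon> \<le> real (card (F i)))"
    and k: "DIM('a) + 1 + (2 * DIM('a) + 1) * m \<le> k" and "k + j \<le> l"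
  shows "real (card (rooted_convex_sets X (k + j))) \<le>
    (real l ^ (2 * DIM('a)) * \<epsilon>) ^ j * real (card (rooted_convex_sets X k))"
  using \<open>k + j \<le> l\<close>
proof (induction j)
  case (Suc j)
  let ?D = "real l ^ (2 * DIM('a)) * \<epsilon>"
  let ?R = "\<lambda>k. real (card (rooted_convex_sets X k))"
  have "(k + j + 1) ^ DIM('a) * (k + j) ^ DIM('a) \<le> l ^ DIM('a) * l ^ DIM('a)"
    using Suc.prems by (intro mult_mono power_mono) auto
  also have "\<dots> = l ^ (2 * DIM('a))" by (simp add: mult_2 power_add)
  finally have "real ((k + j + 1) ^ DIM('a) * (k + j) ^ DIM('a)) \<le> real (l ^ (2 * DIM('a)))"
    by (rule of_nat_mono)
  then have D: "real ((k + j + 1) ^ DIM('a) * (k + j) ^ DIM('a)) * \<epsilon> \<le> ?D"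
    using \<open>0 \<le> \<epsilon>\<close> by (intro mult_right_mono) simp_all
  have "?R (k + Suc j) \<le> ?R (k + j) * (real ((k + j + 1) ^ DIM('a) * (k + j) ^ DIM('a)) * \<epsilon>)"
    using card_rooted_convex_sets_Suc[OF X \<open>0 \<le> \<epsilon>\<close> none, of "k + j"] k by (simp only: add_Suc_right less_Suc_eq_le trans_le_add1)
  also have "\<dots> \<le> ?R (k + j) * ?D"
    using D by (rule mult_left_mono) simp
  also have "\<dots> \<le> (?D ^ j * ?R k) * ?D"
    using Suc \<open>0 \<le> \<epsilon>\<close> by (intro mult_right_mono) auto
  finally show ?case by (simp add: mult_ac)
qed simp

text \<open>Bounding \<open>N choose (8 * n)\<close> by \<open>N ^ (8 * n) / fact (8 * n)\<close>
  cancels the power of \<open>N\<close>, and the ratio of the two binomials in \<open>M\<close>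
  cancels \<open>M ^ n\<close>. What remains bounds \<open>fact (8 * n)\<close>, which is at least
  \<open>fact n * n ^ (7 * n)\<close>.\<close>

lemma fact_le_of_counting:
  fixes n N M :: nat
  assumes n: "n > 0" and N: "8 * n \<le> N" and M: "14 * n \<le> M"
    and le: "real (M choose (8 * n)) \<le> real (N choose (8 * n)) *
      ((real (8 * n) ^ 6 * (real M / real N ^ 8)) ^ n * (real (M choose (7 * n)) * 2 ^ (7 * n)))"
  shows "fact n \<le> (2 ^ 34 :: real) ^ n"
proof -
  define D where "D = real (8 * n) ^ 6 * (real M / real N ^ 8)"
  have D0: "D \<ge> 0" by (simp add: D_def)
  have N0: "real N > 0" and M0: "real M > 0" and n0: "real n > 0" using n N M by auto
  have pos: "real (M choose (7 * n)) > 0"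
    using M by (simp add: zero_less_binomial_iff)
  have "(M choose (8 * n)) * ((8 * n) choose (7 * n)) =
      (M choose (7 * n)) * ((M - 7 * n) choose n)"
    using choose_mult[of "7 * n" "8 * n" M] M by simp
  then have "real (M choose (7 * n)) * real ((M - 7 * n) choose n) =
      real (M choose (8 * n)) * real ((8 * n) choose (7 * n))"
    by (metis of_nat_mult)
  also have "\<dots> \<le> real (M choose (8 * n)) * 2 ^ (8 * n)"
  proof (rule mult_left_mono)
    have "real ((8 * n) choose (7 * n)) \<le> real (2 ^ (8 * n))"
      using binomial_le_pow2 by (rule of_nat_mono)
    then show "real ((8 * n) choose (7 * n)) \<le> 2 ^ (8 * n)" by simp
  qed simp
  also have "\<dots> \<le> real (N choose (8 * n)) *
      (D ^ n * (real (M choose (7 * n)) * 2 ^ (7 * n))) * 2 ^ (8 * n)"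
    using le by (intro mult_right_mono) (simp_all add: D_def)
  also have "\<dots> = real (M choose (7 * n)) *
      (real (N choose (8 * n)) * D ^ n * (2 ^ (7 * n) * 2 ^ (8 * n)))"
    by (simp only: mult_ac)
  finally have 1: "real ((M - 7 * n) choose n) \<le>
      real (N choose (8 * n)) * D ^ n * (2 ^ (7 * n) * 2 ^ (8 * n))"
    using pos by (simp only: mult_le_cancel_left_pos)
  \<comment> \<open>The roots contribute \<open>2 ^ (7 * n)\<close>, the binomial
    \<open>(8 * n) choose (7 * n)\<close> at most \<open>2 ^ (8 * n)\<close>.\<close>
  have "(2 :: real) ^ (7 * n) * 2 ^ (8 * n) = (2 ^ 15) ^ n"
    by (simp only: power_add[symmetric] power_mult[symmetric]) (simp add: algebra_simps)
  note 1 = 1[unfolded this]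
  \<comment> \<open>\<open>14 * n \<le> M\<close> means that \<open>M - 7 * n\<close> is at least
    half of \<open>M\<close>.\<close>
  have "real M / real (2 * n) \<le> real (M - 7 * n) / real n"
    using M n0 by (simp add: field_simps of_nat_diff)
  then have "(real M / real (2 * n)) ^ n \<le> (real (M - 7 * n) / real n) ^ n"
    using M0 n0 by (intro power_mono) auto
  also have "\<dots> \<le> real ((M - 7 * n) choose n)"
    using binomial_ge_n_over_k_pow_k[of n "M - 7 * n", where 'a = real] M by simp
  finally have "(real M / real (2 * n)) ^ n \<le> real (N choose (8 * n)) * D ^ n * (2 ^ 15) ^ n"
    using 1 by simp
  then have "(real M / real (2 * n)) ^ n * fact (8 * n) \<le>
      (real (N choose (8 * n)) * D ^ n * (2 ^ 15) ^ n) * fact (8 * n)"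
    by (rule mult_right_mono) simp
  also have "\<dots> = (real (N choose (8 * n)) * fact (8 * n)) * (D ^ n * (2 ^ 15) ^ n)"
    by (simp only: mult_ac)
  also have "\<dots> \<le> real N ^ (8 * n) * (D ^ n * (2 ^ 15) ^ n)"
  proof (rule mult_right_mono)
    have "real ((N choose (8 * n)) * fact (8 * n)) \<le> real (N ^ (8 * n))"
      using binomial_fact_pow by (rule of_nat_mono)
    then show "real (N choose (8 * n)) * fact (8 * n) \<le> real N ^ (8 * n)" by simp
  qed (use D0 in simp)
  also have "\<dots> = (real N ^ 8 * D * 2 ^ 15) ^ n"
    by (simp only: power_mult power_mult_distrib mult.assoc)
  also have "real N ^ 8 * D = real (8 * n) ^ 6 * real M"
    using N0 by (simp add: D_def)
  finally have "(real M / real (2 * n)) ^ n * fact (8 * n) \<le> (real (8 * n) ^ 6 * real M * 2 ^ 15) ^ n" .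
  \<comment> \<open>The exponent 34 is 18 from \<open>8 ^ 6\<close>, 15 from the powers of two
    above, and 1 from the denominator \<open>2 * n\<close>.\<close>
  also have "real (8 * n) ^ 6 * real M * 2 ^ 15 = (real M / real (2 * n)) * (2 ^ 34 * real n ^ 7)"
    using n0 by (simp add: field_simps flip: power_Suc)
  also have "\<dots> ^ n = (real M / real (2 * n)) ^ n * (2 ^ 34 * real n ^ 7) ^ n"
    by (rule power_mult_distrib)
  finally have "(fact (8 * n) :: real) \<le> (2 ^ 34 * real n ^ 7) ^ n"
    using M0 n0 by (simp only: mult_le_cancel_left_pos zero_less_power divide_pos_pos of_nat_0_less_iff)
  moreover have "(fact n * real n ^ (7 * n) :: real) \<le> fact (8 * n)"
  proof -
    have "real (fact n * n ^ (7 * n)) \<le> real (fact (n + 7 * n))"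
      using fact_mult_power_le_fact_add by (rule of_nat_mono)
    then show ?thesis by simp
  qed
  ultimately have "fact n * real n ^ (7 * n) \<le> (2 ^ 34) ^ n * real n ^ (7 * n)"
    by (simp add: power_mult_distrib power_mult)
  then show ?thesis using n0 by simp
qed

text \<open>If \<open>card X\<close> is at most \<open>N ^ 8\<close>, single points are large enough
  and \<open>n\<close> points in convex position suffice. Otherwise the lower bound from
  supersaturation and the upper bound from successive deletions contradict each other.\<close>

lemma large_family_exists:
  fixes X :: "(real^3) set"
  assumes N_def: "N = ES TYPE(real^3) (8 * n)" and X: "finite X" "in_general_position X" "N \<le> card X"
    and n: "n > 0" "(2 ^ 34 :: real) ^ n < fact n"
  shows "\<exists>T (F :: real^3 \<Rightarrow> (real^3) set). card T = n \<and> family_in_convex_position T F \<and>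
    (\<forall>i\<in>T. F i \<subseteq> X \<and> real (card X) / real N ^ 8 \<le> real (card (F i)))"
proof -
  let ?M = "card X"
  let ?\<epsilon> = "real ?M / real N ^ 8"
  have contains: "\<exists>Y\<subseteq>Z. card Y = 8 * n \<and> convex_independent Y" if "Z \<subseteq> X" "card Z = N" for Z
  proof (rule ES_3_convex_subset)
    show "finite Z" using that X finite_subset by blast
    show "in_general_position Z"
      using in_general_position_subset[OF X(2) that(1)] ES_3_ge_4 that(2) by (simp add: N_def)
    show "card Z = ES TYPE(real^3) (8 * n)" using that(2) by (simp add: N_def)
  qed
  obtain Z where Z: "Z \<subseteq> X" "card Z = N" using X(3) by (metis obtain_subset_with_card_n)
  obtain Y where Y: "Y \<subseteq> Z" "card Y = 8 * n" "convex_independent Y"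
    using contains[OF Z] by blast
  have fZ: "finite Z" using Z X(1) finite_subset by blast
  have N: "8 * n \<le> N" using card_mono[OF fZ Y(1)] Y(2) Z(2) by simp
  show ?thesis
  proof (cases "?M \<le> N ^ 8")
    case True
    obtain T where T: "T \<subseteq> Y" "card T = n"
      using obtain_subset_with_card_n[of n Y] Y(2) by auto
    have "real ?M \<le> real N ^ 8" using True by (metis of_nat_le_iff of_nat_power)
    then have "?\<epsilon> \<le> 1" using N n by (simp add: divide_le_eq)
    moreover have "family_in_convex_position T (\<lambda>x. {x})"
      using convex_independent_subset[OF Y(3) T(1)]
      by (auto simp: family_in_convex_position_def convex_independent_def)
    ultimately show ?thesis
      using T Y(1) Z(1) by (intro exI[of _ T] exI[of _ "\<lambda>x. {x}"]) auto
  next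
    case False
    show ?thesis
    proof (rule ccontr)
      assume no: "\<not> ?thesis"
      obtain m where m: "n = Suc m" using n by (cases n) auto
      have "(N choose (8 * n)) * card {Y. Y \<subseteq> X \<and> card Y = 8 * n \<and> convex_independent Y}
          \<ge> (?M choose (8 * n))"
        by (rule card_subsets_supersaturation[OF X(1,3)]) (rule contains)
      moreover have "card {Y. Y \<subseteq> X \<and> card Y = 8 * n \<and> convex_independent Y}
          \<le> card (rooted_convex_sets X (8 * n))"
      proof (rule surj_card_le[OF finite_rooted_convex_sets[OF X(1)]], rule subsetI)
        fix W assume "W \<in> {Y. Y \<subseteq> X \<and> card Y = 8 * n \<and> convex_independent Y}"
        then have W: "W \<subseteq> X" "card W = 8 * n" "convex_independent W" by auto
        obtain A where "A \<subseteq> W" "card A = 4"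
          using obtain_subset_with_card_n[of 4 W] W(2) n by auto
        then have "(A, W) \<in> rooted_convex_sets X (8 * n)"
          using W by (simp add: rooted_convex_sets_def)
        then show "W \<in> snd ` rooted_convex_sets X (8 * n)" by force
      qed
      ultimately have "(?M choose (8 * n)) \<le> (N choose (8 * n)) * card (rooted_convex_sets X (8 * n))"
        by (meson le_trans mult_le_mono2)
      then have "real (?M choose (8 * n)) \<le> real (N choose (8 * n)) * real (card (rooted_convex_sets X (8 * n)))"
        by (metis of_nat_le_iff of_nat_mult)
      also have "\<dots> \<le> real (N choose (8 * n)) *
          ((real (8 * n) ^ 6 * ?\<epsilon>) ^ n * real (card (rooted_convex_sets X (7 * n))))"
      proof (rule mult_left_mono)
        \<comment> \<open>In dimension three with \<open>n = Suc m\<close>, a small cell exists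
          above size \<open>4 + 7 * m\<close>, which is below \<open>7 * n\<close>; so
          \<open>n\<close> deletions from size \<open>8 * n\<close> are possible.\<close>
        have "real (card (rooted_convex_sets X (7 * n + n))) \<le>
            (real (8 * n) ^ (2 * DIM(real^3)) * ?\<epsilon>) ^ n * real (card (rooted_convex_sets X (7 * n)))"
          by (rule card_rooted_convex_sets_add[OF X(1,2), where m = m]) (use no m in simp_all)
        then show "real (card (rooted_convex_sets X (8 * n))) \<le>
            (real (8 * n) ^ 6 * ?\<epsilon>) ^ n * real (card (rooted_convex_sets X (7 * n)))"
          by simp
      qed simp
      also have "\<dots> \<le> real (N choose (8 * n)) *
          ((real (8 * n) ^ 6 * ?\<epsilon>) ^ n * (real (?M choose (7 * n)) * 2 ^ (7 * n)))"
      proof (intro mult_left_mono)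
        have "real (card (rooted_convex_sets X (7 * n))) \<le> real ((?M choose (7 * n)) * 2 ^ (7 * n))"
          using card_rooted_convex_sets_le[OF X(1)] by (rule of_nat_mono)
        then show "real (card (rooted_convex_sets X (7 * n))) \<le> real (?M choose (7 * n)) * 2 ^ (7 * n)"
          by simp
      qed auto
      finally have count: "real (?M choose (8 * n)) \<le> real (N choose (8 * n)) *
          ((real (8 * n) ^ 6 * ?\<epsilon>) ^ n * (real (?M choose (7 * n)) * 2 ^ (7 * n)))" .
      have "14 * n \<le> 2 * N" using N by simp
      also have "\<dots> \<le> N ^ 2" using N n by (simp add: power2_eq_square)
      also have "\<dots> \<le> N ^ 8"
        using N n by (intro power_increasing) auto
      finally have "14 * n \<le> ?M" using False by simp
      from fact_le_of_counting[OF n(1) N this count] show False using n(2) by simp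
    qed
  qed
qed

theorem theorem1p2:
  "\<exists>n0::nat. n0 > 0 \<and>
     (\<forall>n\<ge>n0. \<forall>\<X> :: (real^3) set.
        finite \<X> \<and> in_general_position \<X> \<and> card \<X> \<ge> ES TYPE(real^3) (8 * n) \<longrightarrow>
        (\<exists>X :: nat \<Rightarrow> (real^3) set.
           (\<forall>i\<in>{1..n}. X i \<subseteq> \<X>) \<and>
           family_in_convex_position {1..n} X \<and>
           (\<forall>i\<in>{1..n}. real (card (X i)) \<ge> real (card \<X>) / real (ES TYPE(real^3) (8 * n)) ^ 8)))"
proof -
  obtain n0 :: nat where n0: "n0 > 0" "\<And>n. n \<ge> n0 \<Longrightarrow> (2 ^ 34 :: real) ^ n < fact n"
    using fact_eventually_gt_power by metis
  have "\<exists>X :: nat \<Rightarrow> (real^3) set. (\<forall>i\<in>{1..n}. X i \<subseteq> \<X>) \<and> family_in_convex_position {1..n} X \<and>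
      (\<forall>i\<in>{1..n}. real (card (X i)) \<ge> real (card \<X>) / real (ES TYPE(real^3) (8 * n)) ^ 8)"
    if n: "n \<ge> n0" and \<X>: "finite \<X>" "in_general_position \<X>" "ES TYPE(real^3) (8 * n) \<le> card \<X>"
    for n and \<X> :: "(real^3) set"
  proof -
    have "n > 0" using n n0(1) by simp
    then obtain T and F :: "real^3 \<Rightarrow> (real^3) set" where T: "card T = n" "family_in_convex_position T F"
        and F: "\<And>i. i \<in> T \<Longrightarrow> F i \<subseteq> \<X>"
          "\<And>i. i \<in> T \<Longrightarrow> real (card \<X>) / real (ES TYPE(real^3) (8 * n)) ^ 8 \<le> real (card (F i))"
      using large_family_exists[OF refl \<X> _ n0(2)[OF n]] by blast
    \<comment> \<open>The family is indexed by points of space; a bijection transports it to the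
      indices from 1 to \<open>n\<close>.\<close>
    have "finite T" using T(1) \<open>n > 0\<close> by (simp add: card_ge_0_finite)
    then obtain g where g: "bij_betw g {1..n} T"
      using ex_bij_betw_nat_finite_1[of T] T(1) by blast
    have gT: "g i \<in> T" if "i \<in> {1..n}" for i using g that by (auto simp: bij_betw_def)
    have "(\<Union>j\<in>{1..n} - {i}. F (g j)) = (\<Union>t\<in>T - {g i}. F t)" if "i \<in> {1..n}" for i
    proof -
      have "T - {g i} = g ` ({1..n} - {i})"
        using g that inj_on_image_set_diff[of g "{1..n}" "{1..n}" "{i}"] by (simp add: bij_betw_def)
      then show ?thesis by simp
    qed
    then have "family_in_convex_position {1..n} (\<lambda>i. F (g i))"
      using T(2) gT unfolding family_in_convex_position_def by simp
    then show ?thesis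
      using F gT by (intro exI[of _ "\<lambda>i. F (g i)"]) auto
  qed
  then show ?thesis using n0(1) by blast
qed

end
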